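(* Let $A$ be an infinite-dimensional unital $C^*$-algebra. Then $\mathrm{E}_2(A)$ does not have the Haagerup property. If $A$ is moreover separable and abelian, then $\mathrm{SL}(2,A)$ does not have the Haagerup property.
   Context: $\mathrm{GL}(2,A)$ is the topological group of invertible elements of $M_2(A)$ with the norm topology. $\mathrm{E}_2(A)$ is the closed subgroup of $\mathrm{GL}(2,A)$ generated by the elementary matrices $\begin{pmatrix} 1 & a \\ 0 & 1 \end{pmatrix}$ and $\begin{pmatrix} 1 & 0 \\ a & 1 \end{pmatrix}$, $a\in A$. For abelian $A$, $\mathrm{SL}(2,A)$ is the subgroup of $\mathrm{GL}(2,A)$ of matrices of determinant $1$. A subset of a topological group $G$ is bounded if it has finite diameter for every continuous left-invariant pseudometric on $G$. $G$ has the Haagerup property if it admits a continuous action by affine isometries on a Hilbert space that is metrically proper: for some (equivalently any) vector $\xi$, $\|g\xi\|\to\infty$ as $g\to\infty$, where $g\to\infty$ means that $g$ eventually leaves every bounded subset of $G$. *)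

theory Defs
  imports "HOL-Analysis.Analysis" "HOL-Algebra.Group_Action"
begin

section \<open>Unital C*-algebras\<close>

text \<open>
  A nonzero unital C*-algebra. Submultiplicativity, completeness and \<open>norm 1 = 1\<close>
  come from the superclasses; the last of these, together with \<open>0 \<noteq> 1\<close>,
  only excludes the zero algebra.
\<close>

class unital_cstar_algebra = real_normed_algebra_1 + banach +
  fixes scaleC :: "complex \<Rightarrow> 'a \<Rightarrow> 'a"  (infixr "*\<^sub>C" 75)
    and star :: "'a \<Rightarrow> 'a"
  assumes scaleC_add_right: "c *\<^sub>C (x + y) = c *\<^sub>C x + c *\<^sub>C y"
    and scaleC_add_left: "(c + d) *\<^sub>C x = c *\<^sub>C x + d *\<^sub>C x"
    and scaleC_scaleC: "c *\<^sub>C d *\<^sub>C x = (c * d) *\<^sub>C x"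
    and scaleC_of_real: "complex_of_real r *\<^sub>C x = r *\<^sub>R x"
    and mult_scaleC_left: "(c *\<^sub>C x) * y = c *\<^sub>C (x * y)"
    and mult_scaleC_right: "x * (c *\<^sub>C y) = c *\<^sub>C (x * y)"
    and norm_scaleC: "norm (c *\<^sub>C x) = cmod c * norm x"
    and star_add: "star (x + y) = star x + star y"
    and star_scaleC: "star (c *\<^sub>C x) = cnj c *\<^sub>C star x"
    and star_mult: "star (x * y) = star y * star x"
    and star_star: "star (star x) = x"
    and norm_star_mult_self: "norm (star x * x) = (norm x)\<^sup>2"

lemma vector_space_scaleC:
  "vector_space (scaleC :: complex \<Rightarrow> 'a \<Rightarrow> 'a::unital_cstar_algebra)"
proof
  show "1 *\<^sub>C x = x" for x :: 'a
    using scaleC_of_real[of 1 x] by simp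
qed (simp_all add: scaleC_add_right scaleC_add_left scaleC_scaleC)

definition infinite_dimensional :: "'a::unital_cstar_algebra itself \<Rightarrow> bool" where
  "infinite_dimensional (_ :: 'a itself) \<longleftrightarrow>
     \<not> (\<exists>B :: 'a set. finite B \<and> module.span scaleC B = UNIV)"


section \<open>Groups of two-by-two matrices\<close>

text \<open>
  The topology of \<^typ>\<open>'a^2^2\<close> is that of entrywise convergence, which is the
  topology of the C*-norm on the matrix algebra.
\<close>

definition GL2 :: "('a::ring_1^2^2) monoid" where
  "GL2 = \<lparr>carrier = {M. invertible M}, mult = (**), one = mat 1\<rparr>"

definition elementary_matrices :: "('a::ring_1^2^2) set" where
  "elementary_matrices =
     range (\<lambda>a. vector [vector [1, a], vector [0, 1]]) \<union>
     range (\<lambda>a. vector [vector [1, 0], vector [a, 1]])"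

definition E2 :: "('a::unital_cstar_algebra^2^2) monoid" where
  "E2 = GL2\<lparr>carrier := \<Inter>{H. subgroup H GL2 \<and> closedin (top_of_set (carrier GL2)) H
                           \<and> elementary_matrices \<subseteq> H}\<rparr>"

text \<open>
  \<^const>\<open>det\<close> needs a commutative ring type, whereas commutativity of the
  algebra is a hypothesis here. The formula is meaningful for commuting entries only.
\<close>

definition det2 :: "'a::ring_1^2^2 \<Rightarrow> 'a" where
  "det2 M = M$1$1 * M$2$2 - M$1$2 * M$2$1"

lemma det2_eq_det: "det2 M = det M" for M :: "'a::comm_ring_1^2^2"
  by (simp add: det2_def det_2)

definition SL2 :: "('a::ring_1^2^2) monoid" where
  "SL2 = GL2\<lparr>carrier := {M \<in> carrier GL2. det2 M = 1}\<rparr>"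

lemma group_GL2: "group (GL2 :: ('a::ring_1^2^2) monoid)"
proof (rule groupI)
  fix M N :: "'a^2^2"
  assume "M \<in> carrier GL2" "N \<in> carrier GL2"
  then obtain M' N' where *: "M ** M' = mat 1" "M' ** M = mat 1" "N ** N' = mat 1" "N' ** N = mat 1"
    by (auto simp: GL2_def invertible_def)
  have "(M ** N) ** (N' ** M') = M ** (N ** N') ** M'"
    and "(N' ** M') ** (M ** N) = N' ** (M' ** M) ** N"
    by (simp_all only: matrix_mul_assoc)
  with * show "M \<otimes>\<^bsub>GL2\<^esub> N \<in> carrier GL2"
    by (auto simp: GL2_def invertible_def)
next
  fix M :: "'a^2^2"
  assume "M \<in> carrier GL2"
  then show "\<exists>N\<in>carrier GL2. N \<otimes>\<^bsub>GL2\<^esub> M = \<one>\<^bsub>GL2\<^esub>"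
    by (auto simp: GL2_def invertible_def)
qed (auto simp: GL2_def invertible_def matrix_mul_assoc)

lemma subgroup_E2: "subgroup (carrier E2) (GL2 :: ('a::unital_cstar_algebra^2^2) monoid)"
proof -
  have "elementary_matrices \<subseteq> carrier (GL2 :: ('a^2^2) monoid)"
  proof -
    have "invertible (vector [vector [1, a], vector [0, 1]] :: 'a^2^2)" for a
      unfolding invertible_def
      by (rule exI[of _ "vector [vector [1, - a], vector [0, 1]]"])
        (simp add: vec_eq_iff matrix_matrix_mult_def mat_def sum_2 forall_2)
    moreover have "invertible (vector [vector [1, 0], vector [a, 1]] :: 'a^2^2)" for a
      unfolding invertible_def
      by (rule exI[of _ "vector [vector [1, 0], vector [- a, 1]]"])
        (simp add: vec_eq_iff matrix_matrix_mult_def mat_def sum_2 forall_2)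
    ultimately show ?thesis
      by (auto simp: elementary_matrices_def GL2_def)
  qed
  moreover have "subgroup (carrier GL2) (GL2 :: ('a^2^2) monoid)"
    by (rule group.subgroup_self[OF group_GL2])
  ultimately show ?thesis
    unfolding E2_def by (auto intro!: group.subgroups_Inter[OF group_GL2])
qed

lemma subgroup_SL2:
  assumes comm: "\<And>x y :: 'a::ring_1. x * y = y * x"
  shows "subgroup (carrier SL2) (GL2 :: ('a^2^2) monoid)"
proof -
  interpret GL2: group "GL2 :: ('a^2^2) monoid"
    by (rule group_GL2)
  have left_comm: "x * (y * z) = y * (x * z)" for x y z :: 'a
    by (metis comm mult.assoc)
  have det2_mult: "det2 (M \<otimes>\<^bsub>GL2\<^esub> N) = det2 M * det2 N" for M N :: "'a^2^2"
    unfolding det2_def GL2_def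
    by (simp add: matrix_matrix_mult_def sum_2 ring_distribs left_diff_distrib right_diff_distrib
        mult.assoc comm left_comm)
  have det2_one: "det2 (\<one>\<^bsub>GL2\<^esub> :: 'a^2^2) = 1"
    by (simp add: det2_def GL2_def mat_def)
  have det2_inv: "det2 (inv\<^bsub>GL2\<^esub> M) = 1" if "M \<in> carrier GL2" "det2 M = 1" for M :: "'a^2^2"
    using det2_mult[of M "inv\<^bsub>GL2\<^esub> M"] that by (simp add: det2_one)
  show ?thesis
    by (rule GL2.subgroupI) (auto simp: SL2_def det2_mult det2_one det2_inv intro!: exI[of _ "\<one>\<^bsub>GL2\<^esub>"])
qed


section \<open>The Haagerup property\<close>

definition left_invariant_pseudometric ::
    "('g, 'b) monoid_scheme \<Rightarrow> ('g \<Rightarrow> 'g \<Rightarrow> real) \<Rightarrow> bool" where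
  "left_invariant_pseudometric G d \<longleftrightarrow>
     (\<forall>x\<in>carrier G. \<forall>y\<in>carrier G. 0 \<le> d x y \<and> d x y = d y x) \<and>
     (\<forall>x\<in>carrier G. d x x = 0) \<and>
     (\<forall>x\<in>carrier G. \<forall>y\<in>carrier G. \<forall>z\<in>carrier G. d x z \<le> d x y + d y z) \<and>
     (\<forall>g\<in>carrier G. \<forall>x\<in>carrier G. \<forall>y\<in>carrier G. d (g \<otimes>\<^bsub>G\<^esub> x) (g \<otimes>\<^bsub>G\<^esub> y) = d x y)"

text \<open>
  Below, \<open>T\<close> is the topology of the group, with \<open>topspace T = carrier G\<close>.
\<close>

definition group_bounded ::
    "('g, 'b) monoid_scheme \<Rightarrow> 'g topology \<Rightarrow> 'g set \<Rightarrow> bool" where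
  "group_bounded G T B \<longleftrightarrow> B \<subseteq> carrier G \<and>
     (\<forall>d. left_invariant_pseudometric G d \<and>
          continuous_map (prod_topology T T) euclideanreal (\<lambda>(x, y). d x y)
          \<longrightarrow> (\<exists>C. \<forall>x\<in>B. \<forall>y\<in>B. d x y \<le> C))"

text \<open>The filter of neighbourhoods of infinity; it is trivial if \<open>G\<close> itself is bounded.\<close>

definition group_at_infinity ::
    "('g, 'b) monoid_scheme \<Rightarrow> 'g topology \<Rightarrow> 'g filter" where
  "group_at_infinity G T = (INF B\<in>{B. group_bounded G T B}. principal (carrier G - B))"

definition affine_isometry :: "('h::real_normed_vector \<Rightarrow> 'h) \<Rightarrow> bool" where
  "affine_isometry f \<longleftrightarrow>
     (\<exists>U b. linear U \<and> f = (\<lambda>x. U x + b)) \<and> (\<forall>x y. dist (f x) (f y) = dist x y)"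

text \<open>
  HOL cannot quantify over Hilbert spaces inside a definition, so the Hilbert space is a type
  parameter: \<open>haagerup_on TYPE('h) G T\<close> says that the Hilbert space \<open>'h\<close> carries an action
  witnessing the Haagerup property of \<open>G\<close>. That \<open>G\<close> lacks the property is
  \<open>\<not> haagerup_on TYPE('h) G T\<close> for arbitrary \<open>'h\<close>. Complex Hilbert spaces
  are covered through their underlying real ones.
\<close>

definition haagerup_on ::
    "'h::{real_inner, complete_space} itself \<Rightarrow> ('g, 'b) monoid_scheme \<Rightarrow> 'g topology \<Rightarrow> bool" where
  "haagerup_on (_ :: 'h itself) G T \<longleftrightarrow>
     (\<exists>\<alpha> :: 'g \<Rightarrow> 'h \<Rightarrow> 'h.
        group_action G UNIV \<alpha> \<and>
        (\<forall>g\<in>carrier G. affine_isometry (\<alpha> g)) \<and>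
        continuous_map (prod_topology T euclidean) euclidean (\<lambda>(g, x). \<alpha> g x) \<and>
        (\<exists>\<xi>. filterlim (\<lambda>g. norm (\<alpha> g \<xi>)) at_top (group_at_infinity G T)))"

end

theory Submission
  imports Defs
begin

text \<open>
  The unipotent matrices \<open>u(a)\<close> leave every bounded subset of the group as the norm of \<open>a\<close> grows,
  so a proper affine isometric action on a Hilbert space restricts to a proper action of the
  additive group of the algebra. An infinite-dimensional C*-algebra contains, for every \<open>n\<close>,
  unit vectors \<open>e\<^sub>1, \<dots>, e\<^sub>n\<close> all of whose subset sums have norm at most \<open>2\<close>: otherwise a
  maximal family of orthogonal self-adjoint elements yields minimal projections with sum \<open>1\<close>,
  whose corners are one-dimensional. After rescaling, the orbit of a vector under these subset sums
  stays in a fixed ball. The variance of this cloud of points is the sum of \<open>n\<close> contributions, one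
  for each \<open>e\<^sub>i\<close>, so for large \<open>n\<close> some \<open>e\<^sub>i\<close> almost fixes a point of the ball. A large
  multiple of \<open>e\<^sub>i\<close> then moves this point by at most \<open>1\<close>, which contradicts properness.
\<close>

section \<open>Square roots in C*-algebras\<close>

lemma star_0 [simp]: "star (0 :: 'a::unital_cstar_algebra) = 0"
  using star_add[of 0 "0::'a"] by simp

lemma star_minus: "star (- x) = - star (x :: 'a::unital_cstar_algebra)"
  using star_add[of x "- x"] by (simp add: eq_neg_iff_add_eq_0 add.commute)

lemma star_diff: "star (x - y) = star x - star (y :: 'a::unital_cstar_algebra)"
  using star_add[of x "- y"] by (simp add: star_minus)

lemma star_scaleR: "star (r *\<^sub>R x) = r *\<^sub>R star (x :: 'a::unital_cstar_algebra)"
  using star_scaleC[of "complex_of_real r" x] by (simp add: scaleC_of_real)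

lemma star_1 [simp]: "star (1 :: 'a::unital_cstar_algebra) = 1"
  using star_mult[of "star 1" "1 :: 'a"] by (simp add: star_star)

lemma star_sum: "star (sum f S) = (\<Sum>i\<in>S. star (f i :: 'a::unital_cstar_algebra))"
  by (induction S rule: infinite_finite_induct) (simp_all add: star_add)

text \<open>The C*-identity and submultiplicativity bound \<open>(norm y)^2\<close> by
  \<open>norm (star y) * norm y\<close>; cancel \<open>norm y\<close>, then exchange
  \<open>y\<close> and \<open>star y\<close>.\<close>

lemma norm_star: "norm (star x) = norm (x :: 'a::unital_cstar_algebra)"
proof -
  have *: "norm y \<le> norm (star y)" for y :: 'a
  proof (cases "y = 0")
    case False
    have "norm y * norm y \<le> norm (star y) * norm y"
      using norm_star_mult_self[of y] norm_mult_ineq[of "star y" y] by (simp add: power2_eq_square)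
    with False show ?thesis by simp
  qed simp
  show ?thesis
    using *[of x] *[of "star x"] by (simp add: star_star)
qed

lemma bounded_linear_star: "bounded_linear (star :: 'a::unital_cstar_algebra \<Rightarrow> 'a)"
  by (rule bounded_linear_intro[of _ 1]) (simp_all add: star_add star_scaleR norm_star)

lemma norm_square_selfadjoint:
  "star x = x \<Longrightarrow> norm (x * x) = (norm (x :: 'a::unital_cstar_algebra))\<^sup>2"
  using norm_star_mult_self[of x] by simp

lemma selfadjoint_square_eq_0:
  "star x = x \<Longrightarrow> x * x = 0 \<Longrightarrow> (x :: 'a::unital_cstar_algebra) = 0"
  using norm_square_selfadjoint[of x] by simp

section \<open>Commutation and bicommutants\<close>

lemma commute_mult:
  fixes x :: "'a::semigroup_mult"
  assumes "x * a = a * x" "x * b = b * x"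
  shows "x * (a * b) = (a * b) * x"
  by (metis assms mult.assoc)

lemma mult_commute_square:
  fixes r :: "'a::semigroup_mult"
  assumes "r * a = a * r"
  shows "a * r * (a * r) = a * a * r * r"
  by (metis assms mult.assoc)

text \<open>Stands in for the functional calculus: the roots below are limits of polynomials in
  \<open>h\<close>, and this is the trace of that origin which survives limits and makes roots
  commute with each other.\<close>

definition in_bicommutant :: "'a::ring_1 \<Rightarrow> 'a \<Rightarrow> bool" where
  "in_bicommutant h a \<longleftrightarrow> (\<forall>y. y * h = h * y \<longrightarrow> y * a = a * y)"

lemma in_bicommutantD: "in_bicommutant h a \<Longrightarrow> y * h = h * y \<Longrightarrow> y * a = a * y"
  by (simp add: in_bicommutant_def)

lemma in_bicommutant_uminus [simp]: "in_bicommutant (- h) a \<longleftrightarrow> in_bicommutant h a"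
  by (simp add: in_bicommutant_def)

lemma in_bicommutant_diff_scalar [simp]:
  "in_bicommutant (h - t *\<^sub>R 1) a \<longleftrightarrow> in_bicommutant h (a :: 'a::real_algebra_1)"
  by (simp add: in_bicommutant_def left_diff_distrib right_diff_distrib)

text \<open>Positivity enters only through this inequality, which compares \<open>a\<close> with \<open>a + \<i>b\<close>.\<close>

lemma norm_square_le_sum_squares:
  fixes a b :: "'a::unital_cstar_algebra"
  assumes "star a = a" "star b = b" "a * b = b * a"
  shows "(norm a)\<^sup>2 \<le> norm (a * a + b * b)"
proof -
  define w where "w = a + \<i> *\<^sub>C b"
  have neg: "(- 1) *\<^sub>C x = - x" for x :: 'a
    using scaleC_of_real[of "- 1" x] by simp
  have sw: "star w = a + (- \<i>) *\<^sub>C b"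
    by (simp add: w_def star_add star_scaleC assms)
  have i0: "(- \<i>) *\<^sub>C x + \<i> *\<^sub>C x = 0" for x :: 'a
    by (simp flip: scaleC_add_left) (use scaleC_of_real[of 0 x] in simp)
  have one: "1 *\<^sub>C x = x" for x :: 'a
    using scaleC_of_real[of 1 x] by simp
  \<comment> \<open>The mixed terms cancel since \<open>a\<close> and \<open>b\<close> commute, so
    the C*-identity evaluates \<open>norm w\<close>; and \<open>norm a <= norm w\<close> because
    \<open>a\<close> is the real part of \<open>w\<close>.\<close>
  have "star w * w = a * a + b * b + ((- \<i>) *\<^sub>C (b * a) + \<i> *\<^sub>C (b * a))"
    unfolding sw unfolding w_def
    by (simp add: distrib_left distrib_right mult_scaleC_left mult_scaleC_right scaleC_scaleC assms
        scaleC_add_right add_ac one neg)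
  then have "(norm w)\<^sup>2 = norm (a * a + b * b)"
    using norm_star_mult_self[of w] by (simp add: i0)
  moreover have "norm a \<le> norm w"
  proof -
    have "w + star w = 2 *\<^sub>R a"
      unfolding sw unfolding w_def using i0[of b] by (simp add: scaleR_2 algebra_simps)
    then have "2 * norm a = norm (w + star w)" by simp
    also have "\<dots> \<le> 2 * norm w"
      using norm_triangle_ineq[of w "star w"] by (simp add: norm_star)
    finally show ?thesis by simp
  qed
  ultimately show ?thesis
    using power_mono[of "norm a" "norm w" 2] by simp
qed

text \<open>
  The iteration \<open>y \<mapsto> (a + y\<^sup>2) / 2\<close> is dominated by the scalar one for \<open>a = 1\<close>,
  which increases to \<open>1\<close>; the square root is \<open>1 - lim y\<close>.
\<close>

lemma square_root_one_minus:
  fixes a :: "'a::unital_cstar_algebra"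
  assumes "norm a \<le> 1"
  shows "\<exists>s. s * s = 1 - a \<and> norm (1 - s) \<le> 1
    \<and> in_bicommutant a s \<and> (star a = a \<longrightarrow> star s = s)"
proof -
  define y where "y = rec_nat 0 (\<lambda>_ y. (1/2) *\<^sub>R (a + y * y))"
  define r :: "nat \<Rightarrow> real" where "r = rec_nat 0 (\<lambda>_ r. (1/2) * (1 + r * r))"
  have y0: "y 0 = 0" and yS: "y (Suc n) = (1/2) *\<^sub>R (a + y n * y n)" for n
    by (simp_all add: y_def)
  have r0: "r 0 = 0" and rS: "r (Suc n) = (1/2) * (1 + r n * r n)" for n
    by (simp_all add: r_def)
  have r: "0 \<le> r n \<and> r n \<le> 1" for n
  proof (induction n)
    case (Suc n)
    then have "r n * r n \<le> 1" by (simp add: mult_le_one)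
    with Suc show ?case by (simp add: rS)
  qed (simp add: r0)
  have ny: "norm (y n) \<le> r n" for n
  proof (induction n)
    case (Suc n)
    have "norm (y n * y n) \<le> r n * r n"
      by (rule order_trans[OF norm_mult_ineq]) (use Suc r in \<open>simp add: mult_mono\<close>)
    then have "norm (a + y n * y n) \<le> 1 + r n * r n"
      using norm_triangle_ineq[of a "y n * y n"] assms by linarith
    then show ?case by (simp add: yS rS)
  qed (simp add: y0 r0)
  have dy: "norm (y (Suc n) - y n) \<le> r (Suc n) - r n" for n
  proof (induction n)
    case 0
    then show ?case using assms by (simp add: y0 r0 yS rS)
  next
    case (Suc n)
    define d where "d = y (Suc n) - y n"
    have "y (Suc (Suc n)) - y (Suc n)
        = (1/2) *\<^sub>R (a + y (Suc n) * y (Suc n)) - (1/2) *\<^sub>R (a + y n * y n)"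
      by (rule arg_cong2[of _ _ _ _ minus]) (rule yS)+
    \<comment> \<open>Noncommutative difference of squares:
      \<open>y'^2 - y^2 = (y' - y) y' + y (y' - y)\<close>.\<close>
    also have "\<dots> = (1/2) *\<^sub>R (d * y (Suc n) + y n * d)"
      unfolding d_def by (simp add: algebra_simps)
    finally have "y (Suc (Suc n)) - y (Suc n) = (1/2) *\<^sub>R (d * y (Suc n) + y n * d)" .
    then have "norm (y (Suc (Suc n)) - y (Suc n)) = (1/2) * norm (d * y (Suc n) + y n * d)"
      by simp
    also have "norm (d * y (Suc n) + y n * d) \<le> norm d * norm (y (Suc n)) + norm (y n) * norm d"
      by (intro norm_triangle_le add_mono norm_mult_ineq)
    also have "\<dots> \<le> (r (Suc n) - r n) * r (Suc n) + r n * (r (Suc n) - r n)"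
      using Suc ny r order_trans[OF norm_ge_zero Suc] unfolding d_def
      by (intro add_mono mult_mono) auto
    finally have "norm (y (Suc (Suc n)) - y (Suc n))
        \<le> (1/2) * ((r (Suc n) - r n) * r (Suc n) + r n * (r (Suc n) - r n))" by simp
    moreover have "r (Suc (Suc n)) - r (Suc n) = (1/2) * (1 + r (Suc n) * r (Suc n)) - (1/2) * (1 + r n * r n)"
      by (rule arg_cong2[of _ _ _ _ minus]) (rule rS)+
    ultimately show ?case by (simp add: algebra_simps)
  qed
  \<comment> \<open>Telescoping gives convergence even for \<open>norm a = 1\<close>, where the
    iteration has Lipschitz bound 1 on the unit ball and a contraction argument fails.\<close>
  have "summable (\<lambda>n. r (Suc n) - r n)"
  proof (rule summableI_nonneg_bounded)
    show "0 \<le> r (Suc n) - r n" for n using dy[of n] norm_ge_zero order_trans by blast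
    show "(\<Sum>i<n. r (Suc i) - r i) \<le> 1" for n using r by (simp add: sum_lessThan_telescope r0)
  qed
  then have "summable (\<lambda>n. y (Suc n) - y n)"
    by (rule summable_comparison_test'[of _ 0]) (rule dy)
  then have "convergent (\<lambda>n. \<Sum>i<n. y (Suc i) - y i)"
    by (simp add: summable_iff_convergent)
  then obtain z where z: "y \<longlonglongrightarrow> z"
    unfolding convergent_def sum_lessThan_telescope y0 by auto
  have "(\<lambda>n. y (Suc n)) \<longlonglongrightarrow> (1/2) *\<^sub>R (a + z * z)"
    unfolding yS by (intro tendsto_intros z)
  then have zz: "z = (1/2) *\<^sub>R (a + z * z)"
    using LIMSEQ_unique[OF LIMSEQ_Suc[OF z]] by blast
  have "2 *\<^sub>R z = a + z * z"
    using arg_cong[OF zz, of "\<lambda>x. 2 *\<^sub>R x"] by simp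
  then have "(1 - z) * (1 - z) = 1 - a"
    by (simp add: algebra_simps scaleR_2)
  \<comment> \<open>This bound lets the construction be applied again, to extract a root of the
    root.\<close>
  moreover have "norm (1 - (1 - z)) \<le> 1"
  proof -
    have "norm (y n) \<le> 1" for n
      by (rule order_trans[OF ny]) (use r in blast)
    then have "norm z \<le> 1"
      by (intro Lim_norm_ubound[OF sequentially_bot z] always_eventually allI)
    then show ?thesis by simp
  qed
  moreover have "in_bicommutant a (1 - z)"
    unfolding in_bicommutant_def
  proof (intro allI impI)
    fix x assume that: "x * a = a * x"
    have "x * y n = y n * x" for n
    proof (induction n)
      case (Suc n)
      have "x * (y n * y n) = y n * x * y n"
        by (simp only: Suc flip: mult.assoc)
      then have "x * (y n * y n) = y n * y n * x"
        by (simp only: Suc mult.assoc)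
      then show ?case by (simp add: yS that distrib_left distrib_right)
    qed (simp add: y0)
    moreover have "(\<lambda>n. x * y n) \<longlonglongrightarrow> x * z" "(\<lambda>n. y n * x) \<longlonglongrightarrow> z * x"
      by (intro tendsto_intros z)+
    ultimately have "x * z = z * x" using LIMSEQ_unique by simp
    then show "x * (1 - z) = (1 - z) * x" by (simp add: algebra_simps)
  qed
  moreover have "star (1 - z) = 1 - z" if "star a = a"
  proof -
    have "star (y n) = y n" for n
      by (induction n) (simp_all add: y0 yS star_add star_scaleR star_mult that)
    then have "star z = z"
      using LIMSEQ_unique[OF bounded_linear.tendsto[OF bounded_linear_star z]] z by simp
    then show ?thesis by (simp add: star_diff)
  qed
  ultimately show ?thesis by blast
qed

text \<open>Rescaling: \<open>M - h = M (1 - h / M)\<close>, with root \<open>sqrt M\<close> times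
  that of the second factor. If \<open>M = 0\<close>, then \<open>h = 0\<close>.\<close>

lemma square_root_scalar_minus:
  fixes h :: "'a::unital_cstar_algebra"
  assumes "star h = h" "norm h \<le> M"
  shows "\<exists>b. b * b = M *\<^sub>R 1 - h \<and> star b = b \<and> in_bicommutant h b"
proof (cases "M = 0")
  case True
  then show ?thesis using assms by (intro exI[of _ 0]) (simp add: in_bicommutant_def)
next
  case False
  then have M: "M > 0" using assms(2) norm_ge_zero[of h] by linarith
  have le: "norm ((1 / M) *\<^sub>R h) \<le> 1"
    using M assms(2) by (simp add: field_simps)
  obtain s where s: "s * s = 1 - (1 / M) *\<^sub>R h" "norm (1 - s) \<le> 1"
    "in_bicommutant ((1 / M) *\<^sub>R h) s"
    "star ((1 / M) *\<^sub>R h) = (1 / M) *\<^sub>R h \<Longrightarrow> star s = s"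
    using square_root_one_minus[OF le] by blast
  show ?thesis
  proof (intro exI[of _ "sqrt M *\<^sub>R s"] conjI allI impI)
    show "sqrt M *\<^sub>R s * sqrt M *\<^sub>R s = M *\<^sub>R 1 - h"
      using M s(1) by (simp add: scaleR_right_diff_distrib)
    show "star (sqrt M *\<^sub>R s) = sqrt M *\<^sub>R s"
      using s(4) assms by (simp add: star_scaleR)
    show "in_bicommutant h (sqrt M *\<^sub>R s)"
      using s(3) M by (simp add: in_bicommutant_def)
  qed
qed

text \<open>Here \<open>a * a\<close> plays the role of the absolute value of \<open>x\<close>.\<close>

lemma square_root_abs:
  fixes x :: "'a::unital_cstar_algebra"
  assumes "star x = x"
  shows "\<exists>a. a * a * (a * a) = x * x \<and> star a = a \<and> in_bicommutant x a"
proof -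
  define M where "M = norm x + 1"
  define x' where "x' = (1 / M) *\<^sub>R x"
  have M: "M > 0" unfolding M_def by (simp add: add_nonneg_pos)
  have sx: "star x' = x'" by (simp add: x'_def star_scaleR assms)
  have nx: "norm x' \<le> 1" using M by (simp add: x'_def field_simps M_def)
  have "norm (x' * x') \<le> 1"
    using norm_square_selfadjoint[OF sx] nx by (simp add: power_le_one)
  \<comment> \<open>This root only serves to bound \<open>norm (1 - x' * x')\<close> by 1: since
    \<open>z^2 + x'^2 = 1\<close>, the sum-of-squares inequality gives
    \<open>norm z <= 1\<close>.\<close>
  obtain z where z: "z * z = 1 - x' * x'" "norm (1 - z) \<le> 1"
    "in_bicommutant (x' * x') z" "star (x' * x') = x' * x' \<Longrightarrow> star z = z"
    using square_root_one_minus[OF \<open>norm (x' * x') \<le> 1\<close>] by blast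
  have zc: "z * x' = x' * z" using in_bicommutantD[OF z(3), of x'] by (simp add: mult.assoc)
  have sz: "star z = z" using z(4) by (simp add: star_mult sx)
  have "(norm z)\<^sup>2 \<le> 1"
    using norm_square_le_sum_squares[OF sz sx zc] z(1) by simp
  then have le: "norm (1 - x' * x') \<le> 1"
    using norm_square_selfadjoint[OF sz] z(1) by simp
  \<comment> \<open>Now \<open>s^2 = x'^2\<close>, and \<open>norm (1 - s) <= 1\<close> permits a
    root \<open>t\<close> of \<open>s\<close>, so that \<open>t^4 = x'^2\<close>.\<close>
  obtain s where s: "s * s = 1 - (1 - x' * x')" "norm (1 - s) \<le> 1"
    "in_bicommutant (1 - x' * x') s"
    "star (1 - x' * x') = 1 - x' * x' \<Longrightarrow> star s = s"
    using square_root_one_minus[OF le] by blast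
  have ss: "star s = s" using s(4) by (simp add: star_mult star_diff sx)
  obtain t where t: "t * t = 1 - (1 - s)" "norm (1 - t) \<le> 1"
    "in_bicommutant (1 - s) t"
    "star (1 - s) = 1 - s \<Longrightarrow> star t = t"
    using square_root_one_minus[OF s(2)] by blast
  show ?thesis
  proof (intro exI[of _ "sqrt M *\<^sub>R t"] conjI allI impI)
    have "t * t * (t * t) = x' * x'" using t(1) s(1) by simp
    then show "sqrt M *\<^sub>R t * sqrt M *\<^sub>R t * (sqrt M *\<^sub>R t * sqrt M *\<^sub>R t) = x * x"
      using M by (simp add: x'_def)
    show "star (sqrt M *\<^sub>R t) = sqrt M *\<^sub>R t"
      using t(4) ss by (simp add: star_scaleR star_diff)
    have "y * sqrt M *\<^sub>R t = sqrt M *\<^sub>R t * y" if y: "y * x = x * y" for y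
    proof -
      from y     have "y * x' = x' * y" by (simp add: x'_def)
      then have "y * (x' * x') = (x' * x') * y" by (intro commute_mult)
      then have "y * s = s * y"
        using in_bicommutantD[OF s(3), of y] by (simp only: left_diff_distrib right_diff_distrib) simp
      then have "y * t = t * y"
        using in_bicommutantD[OF t(3), of y] by (simp only: left_diff_distrib right_diff_distrib) simp
      then show ?thesis by simp
    qed
    then show "in_bicommutant x (sqrt M *\<^sub>R t)" by (simp add: in_bicommutant_def)
  qed
qed

section \<open>Orthogonal families\<close>

lemma selfadjoint_mult_commute:
  "star x = x \<Longrightarrow> star y = y \<Longrightarrow> x * y = y * x \<Longrightarrow> star (x * y) = x * (y :: 'a::unital_cstar_algebra)"
  by (simp add: star_mult)

text \<open>
  In the absence of two orthogonal non-zero elements \<open>x * r\<close> and \<open>y * r\<close>, for every real \<open>t\<close>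
  one of \<open>(h - t) * r\<^sup>2\<close> and \<open>(t - h) * r\<^sup>2\<close> is of the form \<open>a\<^sup>2 * r\<^sup>2\<close>.
  The bound on \<open>h\<close> forces the sign to change, and \<open>h\<close> acts as the scalar where it does.
\<close>

lemma scalar_if_no_orthogonal_pair:
  fixes h r :: "'a::unital_cstar_algebra"
  assumes h: "star h = h" and r: "star r = r" and hr: "h * r = r * h"
    and no_pair: "\<And>x y. \<lbrakk>star x = x; star y = y; x * r = r * x; y * r = r * y; x * y = 0\<rbrakk>
      \<Longrightarrow> x * r = 0 \<or> y * r = 0"
  obtains l :: real where "h * r = l *\<^sub>R r"
proof -
  define M where "M = norm h"
  \<comment> \<open>A substitute for \<open>x\<close> being nonnegative where \<open>r\<close>
    lives. All the roots \<open>a\<close> commute with \<open>r\<close> and with each other, because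
    they lie in the bicommutant of \<open>h\<close>.\<close>
  define P where "P x \<longleftrightarrow> (\<exists>a. star a = a \<and> in_bicommutant h a \<and> x * r = a * a * r)" for x
  have P_or: "P (h - t *\<^sub>R 1) \<or> P (t *\<^sub>R 1 - h)" for t
  proof -
    define x where "x = h - t *\<^sub>R 1"
    have sx: "star x = x" by (simp add: x_def star_diff star_scaleR h)
    obtain a where a: "a * a * (a * a) = x * x" "star a = a" "in_bicommutant x a"
      using square_root_abs[OF sx] by blast
    have ah: "in_bicommutant h a" using a(3) by (simp add: x_def)
    have ra: "r * a = a * r" using in_bicommutantD[OF ah] hr by simp
    have xa: "x * a = a * x" using in_bicommutantD[OF a(3)] by simp
    have xr: "x * r = r * x" using hr by (simp add: x_def algebra_simps)
    have aar: "r * (a * a) = a * a * r" by (rule commute_mult[OF ra ra])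
    have xaa: "x * (a * a) = a * a * x" by (rule commute_mult[OF xa xa])
    \<comment> \<open>With \<open>a * a\<close> as the absolute value of \<open>x\<close>, the
      factors are twice the negative and the positive part; \<open>no_pair\<close> kills one of them
      on \<open>r\<close>.\<close>
    have "(a * a - x) * (a * a + x) = 0"
      by (simp only: distrib_left left_diff_distrib a(1) xaa) simp
    then have "(a * a - x) * r = 0 \<or> (a * a + x) * r = 0"
      using aar xr by (intro no_pair)
        (simp_all only: star_diff star_add star_mult a(2) sx distrib_left distrib_right
          left_diff_distrib right_diff_distrib)
    then have "a * a * r - x * r = 0 \<or> x * r + a * a * r = 0"
      by (simp only: left_diff_distrib distrib_right add.commute)
    then have "x * r = a * a * r \<or> (- x) * r = a * a * r"
      by (simp only: right_minus_eq mult_minus_left neg_eq_iff_add_eq_0) auto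
    moreover have "- x = t *\<^sub>R 1 - h" by (simp add: x_def)
    ultimately show ?thesis
      using a(2) ah unfolding P_def x_def[symmetric] by metis
  qed
  have P_low: "P (h - t *\<^sub>R 1)" if "t \<le> - M" for t
  proof -
    have "star (- h) = - h" "norm (- h) \<le> - t"
      using h that by (simp_all add: star_minus M_def)
    from square_root_scalar_minus[OF this]
    obtain b where "b * b = h - t *\<^sub>R 1" "star b = b" "in_bicommutant h b"
      by auto
    then show ?thesis
      unfolding P_def by metis
  qed
  have P_high: "P (t *\<^sub>R 1 - h)" if "t \<ge> M" for t
  proof -
    show ?thesis
      unfolding P_def using square_root_scalar_minus[OF h, of t] that by (metis M_def)
  qed
  have near: "\<exists>t. norm ((h - t *\<^sub>R 1) * (r * r)) \<le> d * norm (r * r)" if d: "d > 0" for d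
  proof -
    \<comment> \<open>Otherwise \<open>P (h - t)\<close> propagates from \<open>t = - M\<close>
      upwards in steps of \<open>d\<close>; once a step passes \<open>M\<close>,
      \<open>P_high\<close> supplies the missing half.\<close>
    have "\<exists>t. P (h - t *\<^sub>R 1) \<and> P ((t + d) *\<^sub>R 1 - h)"
    proof (rule ccontr)
      assume no: "\<not> ?thesis"
      then have step: "P (h - (t + d) *\<^sub>R 1)" if "P (h - t *\<^sub>R 1)" for t
        using that no P_or by blast
      have "P (h - (- M + real k * d) *\<^sub>R 1)" for k
      proof (induction k)
        case (Suc k)
        then show ?case using step[OF Suc] by (simp add: algebra_simps)
      qed (use P_low[of "- M"] in simp)
      moreover obtain k where "2 * M < real k * d"
        using reals_Archimedean3[OF d] by blast
      then have "P ((- M + real k * d + d) *\<^sub>R 1 - h)"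
        using d by (intro P_high) simp
      ultimately show False
        using no by blast
    qed
    then obtain t a b where a: "star a = a" "in_bicommutant h a" "(h - t *\<^sub>R 1) * r = a * a * r"
      and b: "star b = b" "in_bicommutant h b" "((t + d) *\<^sub>R 1 - h) * r = b * b * r"
      unfolding P_def by blast
    have ra: "r * a = a * r" and rb: "r * b = b * r" using in_bicommutantD[OF a(2)] in_bicommutantD[OF b(2)] hr by simp_all
    have ab: "a * b = b * a" using in_bicommutantD[OF a(2)] in_bicommutantD[OF b(2), of h] by simp
    have sq: "a * r * (a * r) = (h - t *\<^sub>R 1) * (r * r)"
      by (simp only: mult_commute_square[OF ra] flip: a(3)) (simp only: mult.assoc)
    have sq': "b * r * (b * r) = ((t + d) *\<^sub>R 1 - h) * (r * r)"
      by (simp only: mult_commute_square[OF rb] flip: b(3)) (simp only: mult.assoc)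
    have "(a * r) * (b * r) = (b * r) * (a * r)"
      by (intro commute_mult) (simp_all only: ab ra rb commute_mult[symmetric])
    \<comment> \<open>The squares of \<open>a * r\<close> and \<open>b * r\<close> add up to
      \<open>d\<close> times \<open>r * r\<close>, so each is small.\<close>
    then have "(norm (a * r))\<^sup>2 \<le> norm (a * r * (a * r) + b * r * (b * r))"
      using a(1) b(1) ra rb r by (intro norm_square_le_sum_squares selfadjoint_mult_commute) simp_all
    also have "\<dots> = norm (d *\<^sub>R (r * r))"
      unfolding sq sq' by (simp add: algebra_simps)
    finally have "(norm (a * r))\<^sup>2 \<le> d * norm (r * r)" using d by simp
    moreover have "norm ((h - t *\<^sub>R 1) * (r * r)) = (norm (a * r))\<^sup>2"
      unfolding sq[symmetric] using a(1) ra r by (intro norm_square_selfadjoint selfadjoint_mult_commute) simp_all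
    ultimately show ?thesis by metis
  qed
  show ?thesis
  proof (cases "r = 0")
    case True
    then show ?thesis using that[of 0] by simp
  next
    case False
    then have rr: "norm (r * r) > 0"
      using selfadjoint_square_eq_0[OF r] by auto
    have "\<exists>t. norm ((h - t *\<^sub>R 1) * (r * r)) \<le> inverse (real (Suc n)) * norm (r * r)" for n
      by (rule near) simp
    then obtain t where t: "norm ((h - t n *\<^sub>R 1) * (r * r)) \<le> inverse (real (Suc n)) * norm (r * r)" for n
      by metis
    have lim: "(\<lambda>n. (h - t n *\<^sub>R 1) * (r * r)) \<longlonglongrightarrow> 0"
      by (rule Lim_null_comparison[OF always_eventually[OF allI[OF t]]])
        (rule tendsto_mult_left_zero[OF LIMSEQ_inverse_real_of_nat])
    have "(\<lambda>n. h * (r * r) - (h - t n *\<^sub>R 1) * (r * r)) \<longlonglongrightarrow> h * (r * r) - 0"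
      by (intro tendsto_diff tendsto_const lim)
    then have lim': "(\<lambda>n. t n *\<^sub>R (r * r)) \<longlonglongrightarrow> h * (r * r)"
      by (simp add: algebra_simps)
    \<comment> \<open>The multiples \<open>t n\<close> of the fixed nonzero vector
      \<open>r * r\<close> converge, hence so do the coefficients.\<close>
    have "Cauchy t"
    proof (rule metric_CauchyI)
      fix e :: real assume "e > 0"
      then have "e * norm (r * r) > 0" using rr by simp
      then obtain N where "\<And>m n. m \<ge> N \<Longrightarrow> n \<ge> N \<Longrightarrow> dist (t m *\<^sub>R (r * r)) (t n *\<^sub>R (r * r)) < e * norm (r * r)"
        using metric_CauchyD[OF LIMSEQ_imp_Cauchy[OF lim']] by meson
      then have "\<bar>t m - t n\<bar> * norm (r * r) < e * norm (r * r)" if "m \<ge> N" "n \<ge> N" for m n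
        using that by (simp add: dist_norm flip: scaleR_left_diff_distrib)
      then show "\<exists>N. \<forall>m\<ge>N. \<forall>n\<ge>N. dist (t m) (t n) < e"
        using rr by (auto simp: dist_real_def)
    qed
    then obtain l where l: "t \<longlonglongrightarrow> l"
      using convergent_eq_Cauchy by blast
    have "h * (r * r) = l *\<^sub>R (r * r)"
      using LIMSEQ_unique[OF lim' tendsto_scaleR[OF l tendsto_const]] .
    then have z: "(h - l *\<^sub>R 1) * (r * r) = 0" by (simp add: algebra_simps)
    \<comment> \<open>Removes the extra factor \<open>r\<close>: \<open>x\<close> is self-adjoint
      with square 0.\<close>
    define x where "x = (h - l *\<^sub>R 1) * r"
    have c: "(h - l *\<^sub>R 1) * r = r * (h - l *\<^sub>R 1)" using hr by (simp add: algebra_simps)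
    have "x * x = (h - l *\<^sub>R 1) * ((h - l *\<^sub>R 1) * (r * r))"
      unfolding x_def mult_commute_square[OF c[symmetric]] by (simp only: mult.assoc)
    then have "x * x = 0" by (simp only: z mult_zero_right)
    moreover have "star (h - l *\<^sub>R 1) = h - l *\<^sub>R 1" by (simp add: star_diff star_scaleR h)
    then have "star x = x"
      unfolding x_def by (intro selfadjoint_mult_commute c r)
    ultimately have "x = 0" by (metis selfadjoint_square_eq_0)
    then show ?thesis by (intro that[of l]) (simp add: x_def left_diff_distrib)
  qed
qed

text \<open>Self-adjoint elements rather than projections: the continuous functions on an interval
  have only the projections 0 and 1, yet infinitely many functions of disjoint support.\<close>

definition orthogonal_family :: "'a::unital_cstar_algebra set \<Rightarrow> bool" where
  "orthogonal_family E \<longleftrightarrow> (\<forall>x\<in>E. star x = x \<and> x \<noteq> 0) \<and> (\<forall>x\<in>E. \<forall>y\<in>E. x \<noteq> y \<longrightarrow> x * y = 0)"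

text \<open>Orthogonality makes the square of the sum the sum of the squares, and squaring a
  self-adjoint element squares its norm. After \<open>k\<close> squarings the triangle inequality
  applies.\<close>

lemma norm_sum_orthogonal_power:
  fixes e :: "'i \<Rightarrow> 'a::unital_cstar_algebra"
  assumes "\<And>i. i \<in> S \<Longrightarrow> star (e i) = e i"
    and "\<And>i j. i \<in> S \<Longrightarrow> j \<in> S \<Longrightarrow> i \<noteq> j \<Longrightarrow> e i * e j = 0"
    and "\<And>i. i \<in> S \<Longrightarrow> norm (e i) \<le> 1"
  shows "norm (sum e S) ^ (2 ^ k) \<le> real (card S)"
  using assms
proof (induction k arbitrary: e)
  case 0
  then show ?case using sum_norm_bound[of S e 1] by simp
next
  case (Suc k)
  show ?case
  proof (cases "finite S")
    case True
    have sa: "star (sum e S) = sum e S"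
      using Suc.prems(1) by (simp add: star_sum)
    have "e i * sum e S = e i * e i" if "i \<in> S" for i
    proof -
      have "(\<Sum>j\<in>S. e i * e j) = (\<Sum>j\<in>S. if j = i then e i * e i else 0)"
        using Suc.prems(2) that by (intro sum.cong) auto
      then show ?thesis using True that by (simp add: sum_distrib_left)
    qed
    then have eq: "sum e S * sum e S = (\<Sum>i\<in>S. e i * e i)"
      by (simp add: sum_distrib_right)
    have "norm (sum e S) ^ (2 ^ Suc k) = (norm (sum e S * sum e S)) ^ (2 ^ k)"
      by (simp add: norm_square_selfadjoint[OF sa] flip: power_mult)
    also have "\<dots> \<le> real (card S)"
      unfolding eq
    proof (rule Suc.IH)
      fix i assume i: "i \<in> S"
      show "star (e i * e i) = e i * e i" by (simp add: star_mult Suc.prems(1)[OF i])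
      show "norm (e i * e i) \<le> 1"
        by (simp add: norm_square_selfadjoint[OF Suc.prems(1)[OF i]] power_le_one Suc.prems(3)[OF i])
      fix j assume "j \<in> S" "i \<noteq> j"
      then have "e i * (e i * e j) * e j = 0" using Suc.prems(2)[OF i] by simp
      then show "e i * e i * (e j * e j) = 0" by (simp only: mult.assoc)
    qed
    finally show ?thesis .
  qed (simp add: power_0_left)
qed

text \<open>Letting \<open>k\<close> grow would give 1; the single choice \<open>k = card S\<close>
  gives 2, as \<open>n < 2^n <= 2^(2^n)\<close>.\<close>

lemma norm_sum_orthogonal_le:
  fixes e :: "'i \<Rightarrow> 'a::unital_cstar_algebra"
  assumes "\<And>i. i \<in> S \<Longrightarrow> star (e i) = e i"
    and "\<And>i j. i \<in> S \<Longrightarrow> j \<in> S \<Longrightarrow> i \<noteq> j \<Longrightarrow> e i * e j = 0"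
    and "\<And>i. i \<in> S \<Longrightarrow> norm (e i) \<le> 1"
  shows "norm (sum e S) \<le> 2"
proof -
  let ?N = "2 ^ card S :: nat"
  have "norm (sum e S) ^ ?N \<le> real (card S)"
    using assms by (rule norm_sum_orthogonal_power)
  also have "\<dots> < 2 ^ card S" by (rule of_nat_less_two_power)
  also have "\<dots> \<le> 2 ^ ?N" by (intro power_increasing) (simp_all add: less_imp_le)
  finally show ?thesis using power_less_imp_less_base[of "norm (sum e S)" ?N 2] by simp
qed

text \<open>Trading \<open>e\<close> for nonzero \<open>u\<close> and \<open>v\<close> would enlarge
  a family of largest size. Both are right multiples of \<open>e\<close>, so the other members
  annihilate them, on either side by applying \<open>star\<close>.\<close>

lemma replace_in_orthogonal_family:
  fixes E :: "'a::unital_cstar_algebra set"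
  assumes E: "finite E" "orthogonal_family E" "e \<in> E"
    and max: "\<And>E' :: 'a set. finite E' \<Longrightarrow> orthogonal_family E' \<Longrightarrow> card E' \<le> card E"
    and uv: "star u = u" "star v = v" "u = e * u'" "v = e * v'" "u * v = 0"
  shows "u = 0 \<or> v = 0"
proof (rule ccontr)
  assume "\<not> ?thesis"
  then have nz: "u \<noteq> 0" "v \<noteq> 0" by auto
  have vu: "v * u = 0"
    using star_mult[of u v] uv by simp
  define F where "F = E - {e}"
  have orth: "f * (e * w) = 0" if "f \<in> F" for f w
    using that E by (simp add: F_def orthogonal_family_def flip: mult.assoc)
  have fu: "f * u = 0" "f * v = 0" if "f \<in> F" for f
    using orth[OF that] uv by simp_all
  have uf: "u * f = 0" "v * f = 0" if "f \<in> F" for f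
  proof -
    have "star f = f" using that E by (simp add: F_def orthogonal_family_def)
    then show "u * f = 0" "v * f = 0"
      using fu[OF that] star_mult[of f u] star_mult[of f v] uv by simp_all
  qed
  have F: "star f = f" "f \<noteq> 0" "f * f \<noteq> 0" if "f \<in> F" for f
    using that E selfadjoint_square_eq_0[of f] by (auto simp: F_def orthogonal_family_def)
  \<comment> \<open>Needed for the count: any coincidence would give a nonzero self-adjoint element
    with square 0.\<close>
  have "u \<noteq> v" "u \<notin> F" "v \<notin> F"
    using fu(1)[of u] fu(2)[of v] F(3) nz(1) uv(5) selfadjoint_square_eq_0[OF uv(1)] by metis+
  moreover have "orthogonal_family (insert u (insert v F))"
  proof -
    have "orthogonal_family F"
      using E by (auto simp: F_def orthogonal_family_def)
    then show ?thesis
      using fu uf nz uv vu by (auto simp: orthogonal_family_def)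
  qed
  moreover have "finite F" "card E = Suc (card F)"
    using E card_Suc_Diff1[of E e] by (simp_all add: F_def)
  ultimately show False
    using max[of "insert u (insert v F)"] by simp
qed

text \<open>\<open>scalar_if_no_orthogonal_pair\<close> with \<open>h = r = e\<close>; maximality
  excludes the pairs. So \<open>e\<close> is a multiple of a projection.\<close>

lemma maximal_orthogonal_family_multiple:
  fixes E :: "'a::unital_cstar_algebra set"
  assumes E: "finite E" "orthogonal_family E" "e \<in> E"
    and max: "\<And>E' :: 'a set. finite E' \<Longrightarrow> orthogonal_family E' \<Longrightarrow> card E' \<le> card E"
  shows "\<exists>l :: real. l \<noteq> 0 \<and> e * e = l *\<^sub>R e"
proof -
  have se: "star e = e" and nz: "e \<noteq> 0" using E by (auto simp: orthogonal_family_def)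
  obtain l where l: "e * e = l *\<^sub>R e"
  proof (rule scalar_if_no_orthogonal_pair[OF se se refl])
    fix x y assume x: "star x = x" "x * e = e * x" and y: "star y = y" "y * e = e * y" and xy: "x * y = 0"
    have "x * e * (y * e) = x * y * (e * e)"
      using y(2) by (metis mult.assoc)
    then have "x * e * (y * e) = 0" by (simp add: xy)
    then show "x * e = 0 \<or> y * e = 0"
      using x y se by (intro replace_in_orthogonal_family[OF E max, where u' = x and v' = y] selfadjoint_mult_commute) simp_all
  qed
  moreover have "l \<noteq> 0"
    using l nz selfadjoint_square_eq_0[OF se] by auto
  ultimately show ?thesis by blast
qed

text \<open>\<open>scalar_if_no_orthogonal_pair\<close> with \<open>r = p\<close> makes self-adjoint
  elements of the corner real multiples of \<open>p\<close>; the rest follows by splitting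
  \<open>a\<close>.\<close>

lemma corner_of_minimal_projection:
  fixes E :: "'a::unital_cstar_algebra set"
  assumes E: "finite E" "orthogonal_family E" "p \<in> E"
    and max: "\<And>E' :: 'a set. finite E' \<Longrightarrow> orthogonal_family E' \<Longrightarrow> card E' \<le> card E"
    and pp: "p * p = p"
  shows "\<exists>c. p * a * p = c *\<^sub>C p"
proof -
  have sp: "star p = p" using E by (auto simp: orthogonal_family_def)
  have sa: "\<exists>l :: real. h = l *\<^sub>R p" if h: "star h = h" "h = p * b * p" for h b
  proof -
    have hp: "h * p = h" "p * h = h" by (simp_all add: h(2) mult.assoc pp) (simp add: pp flip: mult.assoc)
    obtain l where "h * p = l *\<^sub>R p"
    proof (rule scalar_if_no_orthogonal_pair[OF h(1) sp])
      fix x y assume x: "star x = x" "x * p = p * x" and y: "star y = y" "y * p = p * y" and xy: "x * y = 0"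
      have "x * p * (y * p) = x * y * (p * p)"
        using y(2) by (metis mult.assoc)
      then have "x * p * (y * p) = 0" by (simp add: xy)
      then show "x * p = 0 \<or> y * p = 0"
        using x y sp by (intro replace_in_orthogonal_family[OF E max, where u' = x and v' = y] selfadjoint_mult_commute) simp_all
    qed (simp add: hp)
    then show ?thesis by (auto simp: hp)
  qed
  \<comment> \<open>Twice the real part and minus twice the imaginary part of
    \<open>a\<close>.\<close>
  define a1 where "a1 = a + star a"
  define a2 where "a2 = \<i> *\<^sub>C (a - star a)"
  have "star a1 = a1" by (simp add: a1_def star_add star_star add.commute)
  moreover have "star a2 = a2"
  proof -
    have "star a2 = (- \<i>) *\<^sub>C (star a - a)" by (simp add: a2_def star_scaleC star_diff star_star)
    also have "\<dots> = (- \<i>) *\<^sub>C ((- 1) *\<^sub>C (a - star a))"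
      using scaleC_of_real[of "- 1" "a - star a"] by simp
    finally show ?thesis by (simp add: scaleC_scaleC a2_def)
  qed
  ultimately have "star (p * a1 * p) = p * a1 * p" "star (p * a2 * p) = p * a2 * p"
    by (simp_all add: star_mult sp mult.assoc)
  then obtain l1 l2 where l: "p * a1 * p = l1 *\<^sub>R p" "p * a2 * p = l2 *\<^sub>R p"
    using sa[OF _ refl] by meson
  have a: "a = (1/2) *\<^sub>C (a1 + (- \<i>) *\<^sub>C a2)"
  proof -
    have "(- \<i>) *\<^sub>C a2 = a - star a"
      using scaleC_of_real[of 1 "a - star a"] by (simp add: a2_def scaleC_scaleC)
    then have "a1 + (- \<i>) *\<^sub>C a2 = 2 *\<^sub>R a" by (simp add: a1_def scaleR_2)
    then show ?thesis using scaleC_of_real[of "1/2" "2 *\<^sub>R a"] by simp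
  qed
  have "p * a * p = p * ((1/2) *\<^sub>C (a1 + (- \<i>) *\<^sub>C a2)) * p"
    by (simp only: flip: a)
  also have "\<dots> = (1/2) *\<^sub>C (p * a1 * p + (- \<i>) *\<^sub>C (p * a2 * p))"
    by (simp only: distrib_left distrib_right mult_scaleC_left mult_scaleC_right)
  also have "\<dots> = ((1/2) * (complex_of_real l1 + (- \<i>) * complex_of_real l2)) *\<^sub>C p"
    by (simp only: l scaleC_scaleC scaleC_add_left scaleC_add_right distrib_left flip: scaleC_of_real)
  finally show ?thesis by blast
qed

text \<open>A largest family rescales to projections \<open>P\<close> with sum 1, so the algebra is
  the sum of the finitely many blocks \<open>p A q\<close>, each of dimension at most one.\<close>

lemma finite_dimensional_if_orthogonal_families_bounded:
  assumes bounded: "\<And>E :: 'a::unital_cstar_algebra set. finite E \<Longrightarrow> orthogonal_family E \<Longrightarrow> card E \<le> N"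
  shows "\<not> infinite_dimensional TYPE('a)"
proof -
  interpret vs: vector_space "scaleC :: complex \<Rightarrow> 'a \<Rightarrow> 'a" by (rule vector_space_scaleC)
  have "\<exists>E :: 'a set. (finite E \<and> orthogonal_family E) \<and>
    (\<forall>E' :: 'a set. finite E' \<and> orthogonal_family E' \<longrightarrow> card E' \<le> card E)"
    by (rule Lattices_Big.ex_has_greatest_nat[of "\<lambda>E. finite E \<and> orthogonal_family E" "{}" card "Suc N"])
      (use bounded in \<open>auto simp: orthogonal_family_def less_Suc_eq_le\<close>)
  then obtain E :: "'a set" where E: "finite E" "orthogonal_family E"
    and max: "\<And>E' :: 'a set. finite E' \<Longrightarrow> orthogonal_family E' \<Longrightarrow> card E' \<le> card E"
    by blast
  obtain l :: "'a \<Rightarrow> real" where l: "\<And>e. e \<in> E \<Longrightarrow> l e \<noteq> 0 \<and> e * e = l e *\<^sub>R e"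
    using maximal_orthogonal_family_multiple[OF E _ max] by metis
  \<comment> \<open>Makes \<open>e\<close> idempotent. As \<open>f\<close> is injective on
    \<open>E\<close>, the family \<open>P\<close> again has the largest size.\<close>
  define f where "f e = (1 / l e) *\<^sub>R e" for e
  define P where "P = f ` E"
  have f_ne: "f x \<noteq> f y" if "x \<in> E" "y \<in> E" "x \<noteq> y" for x y
  proof
    assume eq: "f x = f y"
    have "f x * f y = 0" using that E by (simp add: f_def orthogonal_family_def)
    then have "f x * f x = 0" by (simp add: eq)
    then show False using l[OF that(1)] E that(1) by (auto simp: f_def orthogonal_family_def)
  qed
  have fP: "finite P" using E by (simp add: P_def)
  have cardP: "card P = card E"
    unfolding P_def by (intro card_image inj_onI) (use f_ne in blast)
  have oP: "orthogonal_family P"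
    using E l by (auto simp: P_def orthogonal_family_def f_def star_scaleR)
  have maxP: "\<And>E' :: 'a set. finite E' \<Longrightarrow> orthogonal_family E' \<Longrightarrow> card E' \<le> card P"
    using max cardP by simp
  have pp: "p * p = p" if "p \<in> P" for p
    using that l by (auto simp: P_def f_def)
  have sp: "star p = p" and pq: "q \<in> P \<Longrightarrow> p \<noteq> q \<Longrightarrow> p * q = 0" if "p \<in> P" for p q
    using oP that by (auto simp: orthogonal_family_def)
  have p_sum: "p * \<Sum>P = p" if "p \<in> P" for p
  proof -
    have "p * \<Sum>P = (\<Sum>q\<in>P. if q = p then p else 0)"
      unfolding sum_distrib_left using pp pq that by (intro sum.cong) auto
    then show ?thesis using fP that by simp
  qed
  have sum_one: "\<Sum>P = 1"
  proof (rule ccontr)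
    assume ne: "\<Sum>P \<noteq> 1"
    \<comment> \<open>A nonzero \<open>q\<close> would be orthogonal to all of \<open>P\<close> and
      extend it.\<close>
    define q where "q = 1 - \<Sum>P"
    have sq: "star q = q" using sp by (simp add: q_def star_diff star_sum)
    have pq0: "p * q = 0" if "p \<in> P" for p using p_sum[OF that] by (simp add: q_def algebra_simps)
    have qp0: "q * p = 0" if "p \<in> P" for p
      using star_mult[of p q] pq0[OF that] sq sp[OF that] by simp
    have "q \<notin> P" using pq0 pp oP by (force simp: orthogonal_family_def)
    moreover have "orthogonal_family (insert q P)"
      using oP sq pq0 qp0 ne by (auto simp: orthogonal_family_def q_def)
    ultimately show False using maxP[of "insert q P"] fP by simp
  qed
  have corner: "\<exists>c. p * a * p = c *\<^sub>C p" if "p \<in> P" for p a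
    by (rule corner_of_minimal_projection[OF fP oP that maxP pp[OF that]])
  \<comment> \<open>For a nonzero \<open>v\<close> in the block, \<open>v * star v = m p\<close>
    with \<open>m\<close> nonzero and \<open>star v * (p a q) = n q\<close>, whence
    \<open>m (p a q) = n v\<close>.\<close>
  have "\<exists>v. \<forall>a. \<exists>c. p * a * q = c *\<^sub>C v" if p: "p \<in> P" and q: "q \<in> P" for p q
  proof (cases "\<exists>b. p * b * q \<noteq> 0")
    case False
    then show ?thesis by (intro exI[of _ 0]) simp
  next
    case True
    then obtain b where v: "p * b * q \<noteq> 0" by blast
    define v where "v = p * b * q"
    have sv: "star v = q * star b * p" by (simp add: v_def star_mult sp p q mult.assoc)
    have "v * star v = p * (b * q * q * star b) * p"
      unfolding sv unfolding v_def by (simp only: mult.assoc)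
    then obtain m where m: "v * star v = m *\<^sub>C p"
      using corner[OF p, of "b * q * q * star b"] by auto
    have "v * star v \<noteq> 0"
      using norm_star_mult_self[of "star v"] v by (auto simp: star_star norm_star v_def[symmetric])
    then have m0: "m \<noteq> 0" using m by auto
    have "\<exists>c. p * a * q = c *\<^sub>C v" for a
    proof -
      have "star v * (p * a * q) = q * (star b * p * p * a) * q"
        unfolding sv by (simp only: mult.assoc)
      then obtain n where n: "star v * (p * a * q) = n *\<^sub>C q"
        using corner[OF q, of "star b * p * p * a"] by auto
      have "m *\<^sub>C (p * a * q) = m *\<^sub>C (p * (p * a * q))"
        by (simp add: pp[OF p] flip: mult.assoc)
      also have "\<dots> = v * (star v * (p * a * q))"
        by (simp add: m mult_scaleC_left flip: mult.assoc)
      also have "\<dots> = n *\<^sub>C v"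
        unfolding n by (simp add: mult_scaleC_right) (simp add: v_def mult.assoc pp[OF q])
      finally have "(1/m) *\<^sub>C m *\<^sub>C (p * a * q) = (1/m) *\<^sub>C n *\<^sub>C v" by simp
      then have "p * a * q = (n / m) *\<^sub>C v" using m0 by (simp add: scaleC_scaleC)
      then show ?thesis by blast
    qed
    then show ?thesis by blast
  qed
  then obtain v where v: "\<And>p q a. p \<in> P \<Longrightarrow> q \<in> P \<Longrightarrow> \<exists>c. p * a * q = c *\<^sub>C v p q"
    by metis
  let ?B = "(\<lambda>(p, q). v p q) ` (P \<times> P)"
  have "a \<in> vs.span ?B" for a
  proof -
    have "a = \<Sum>P * a * \<Sum>P" by (simp add: sum_one)
    also have "\<dots> = (\<Sum>p\<in>P. \<Sum>q\<in>P. p * a * q)"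
      by (simp add: sum_distrib_right) (simp add: sum_distrib_left)
    also have "\<dots> \<in> vs.span ?B"
    proof (intro vs.span_sum)
      fix p q assume pq: "p \<in> P" "q \<in> P"
      then obtain c where "p * a * q = c *\<^sub>C v p q" using v by blast
      moreover have "v p q \<in> vs.span ?B" using pq by (intro vs.span_base) force
      ultimately show "p * a * q \<in> vs.span ?B" by (simp add: vs.span_scale)
    qed
    finally show ?thesis .
  qed
  moreover have "finite ?B" using fP by simp
  ultimately show ?thesis
    unfolding infinite_dimensional_def by blast
qed

lemma infinite_dimensional_bounded_subset_sums:
  assumes "infinite_dimensional TYPE('a::unital_cstar_algebra)"
  shows "\<exists>e :: nat \<Rightarrow> 'a. (\<forall>i<n. norm (e i) = 1) \<and> (\<forall>S\<subseteq>{..<n}. norm (sum e S) \<le> 2)"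
proof -
  obtain E :: "'a set" where E: "finite E" "orthogonal_family E" "n < card E"
    using finite_dimensional_if_orthogonal_families_bounded[of n] assms by (meson not_le)
  obtain g :: "nat \<Rightarrow> 'a" where g: "bij_betw g {..<card E} E"
    using ex_bij_betw_nat_finite[OF E(1)] by (auto simp: atLeast0LessThan)
  define e where "e i = (1 / norm (g i)) *\<^sub>R g i" for i
  have gE: "g i \<in> E" if "i < n" for i using g E(3) that by (auto simp: bij_betw_def)
  have g_ne: "g i \<noteq> g j" if "i < n" "j < n" "i \<noteq> j" for i j
    using g E(3) that by (auto simp: bij_betw_def inj_on_def)
  have 1: "norm (e i) = 1" "star (e i) = e i" if "i < n" for i
    using gE[OF that] E(2) by (auto simp: e_def orthogonal_family_def star_scaleR)
  have 2: "e i * e j = 0" if "i < n" "j < n" "i \<noteq> j" for i j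
    using gE g_ne that E(2) by (auto simp: e_def orthogonal_family_def)
  have "norm (sum e S) \<le> 2" if "S \<subseteq> {..<n}" for S
    using that 1 2 by (intro norm_sum_orthogonal_le) (auto simp: subset_iff)
  then show ?thesis using 1 by blast
qed

section \<open>Isometric actions on Hilbert spaces\<close>

text \<open>The parallelogram law for \<open>x - p\<close> and \<open>y - p\<close>; here the inner
  product enters.\<close>

lemma midpoint_dist_square:
  fixes x y p :: "'h::real_inner"
  shows "(dist ((1/2) *\<^sub>R (x + y)) p)\<^sup>2 = ((dist x p)\<^sup>2 + (dist y p)\<^sup>2) / 2 - (dist x y)\<^sup>2 / 4"
proof -
  define u where "u = x - p"
  define v where "v = y - p"
  have "(1/2) *\<^sub>R (x + y) - p = (1/2) *\<^sub>R (u + v)"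
    by (simp add: u_def v_def algebra_simps flip: scaleR_add_left)
  moreover have "x - y = u - v"
    by (simp add: u_def v_def)
  ultimately show ?thesis
    unfolding dist_norm u_def[symmetric] v_def[symmetric]
    by (simp only:) (simp add: power2_norm_eq_inner inner_simps inner_commute field_simps)
qed

text \<open>
  The points \<open>w i\<close> are the barycentres of the orbit points over subsets of the first \<open>i\<close>
  elements, and the sum on the left is the variance of this cloud.
\<close>

lemma barycentre_variance:
  fixes \<beta> :: "'a::ab_group_add \<Rightarrow> 'h::real_inner \<Rightarrow> 'h"
  assumes add: "\<And>a b x. \<beta> (a + b) x = \<beta> a (\<beta> b x)" and zero: "\<And>x. \<beta> 0 x = x"
    and iso: "\<And>a x y. dist (\<beta> a x) (\<beta> a y) = dist x y"
    and w0: "w 0 = \<xi>" and wS: "\<And>i. w (Suc i) = (1/2) *\<^sub>R (w i + \<beta> (e i) (w i))"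
  shows "\<exists>S\<subseteq>{..<n}. (\<Sum>i<n. (dist (w i) (\<beta> (e i) (w i)))\<^sup>2 / 4) + (dist (w n) p)\<^sup>2
    \<le> (dist (\<beta> (sum e S) \<xi>) p)\<^sup>2"
proof (induction n arbitrary: p)
  case 0
  then show ?case by (simp add: w0 zero)
next
  case (Suc n)
  let ?V = "\<Sum>i<n. (dist (w i) (\<beta> (e i) (w i)))\<^sup>2 / 4"
  \<comment> \<open>The translated half of the cloud seen from \<open>p\<close> is the first half
    seen from \<open>\<beta> (- e n) p\<close>, so the induction hypothesis is used at both
    points.\<close>
  have inv: "dist (\<beta> (e n) x) p = dist x (\<beta> (- e n) p)" for x
    using iso[of "e n" x "\<beta> (- e n) p"] by (simp add: zero flip: add)
  have eq: "(\<Sum>i<Suc n. (dist (w i) (\<beta> (e i) (w i)))\<^sup>2 / 4) + (dist (w (Suc n)) p)\<^sup>2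
      = ?V + ((dist (w n) p)\<^sup>2 + (dist (w n) (\<beta> (- e n) p))\<^sup>2) / 2"
    by (simp add: wS midpoint_dist_square inv)
  obtain S where S: "S \<subseteq> {..<n}" "?V + (dist (w n) p)\<^sup>2 \<le> (dist (\<beta> (sum e S) \<xi>) p)\<^sup>2"
    using Suc by blast
  obtain S' where S': "S' \<subseteq> {..<n}"
    "?V + (dist (w n) (\<beta> (- e n) p))\<^sup>2 \<le> (dist (\<beta> (sum e S') \<xi>) (\<beta> (- e n) p))\<^sup>2"
    using Suc by blast
  have "sum e (insert n S') = e n + sum e S'"
    using S'(1) by (subst sum.insert) (auto dest: finite_subset)
  then have "dist (\<beta> (sum e S') \<xi>) (\<beta> (- e n) p) = dist (\<beta> (sum e (insert n S')) \<xi>) p"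
    by (simp add: add flip: inv)
  with S S' have "S \<subseteq> {..<Suc n}" "insert n S' \<subseteq> {..<Suc n}"
    "?V + (dist (w n) (\<beta> (- e n) p))\<^sup>2 \<le> (dist (\<beta> (sum e (insert n S')) \<xi>) p)\<^sup>2"
    by auto
  \<comment> \<open>The left side is an average of two terms; the subset belonging to the larger one
    works.\<close>
  with S(2) show ?case
    unfolding eq by (cases "dist (w n) p \<le> dist (w n) (\<beta> (- e n) p)")
      (smt (verit, del_insts) field_sum_of_halves power_mono zero_le_dist)+
qed

text \<open>Among \<open>n\<close> terms \<open>m i^2 / 4\<close> with sum at most 1, one is at most
  \<open>1 / n\<close>, and \<open>n > 4 R^2\<close> makes \<open>R m i <= 1\<close>. The same
  variance bound keeps \<open>w i\<close> within 1 of \<open>\<xi>\<close>; going to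
  \<open>w i\<close> and back adds 2, hence 3.\<close>

lemma small_subset_sums_imp_small_multiple:
  fixes \<beta> :: "'a::real_vector \<Rightarrow> 'h::real_inner \<Rightarrow> 'h"
  assumes add: "\<And>a b x. \<beta> (a + b) x = \<beta> a (\<beta> b x)" and zero: "\<And>x. \<beta> 0 x = x"
    and iso: "\<And>a x y. dist (\<beta> a x) (\<beta> a y) = dist x y"
    and small: "\<And>S. S \<subseteq> {..<n} \<Longrightarrow> dist (\<beta> (sum e S) \<xi>) \<xi> \<le> 1"
    and n: "n = 4 * R\<^sup>2 + 1"
  shows "\<exists>i<n. dist (\<beta> (real R *\<^sub>R e i) \<xi>) \<xi> \<le> 3"
proof -
  define w where "w = rec_nat \<xi> (\<lambda>i x. (1/2) *\<^sub>R (x + \<beta> (e i) x))"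
  define m where "m i = dist (w i) (\<beta> (e i) (w i))" for i
  have w: "w 0 = \<xi>" "\<And>i. w (Suc i) = (1/2) *\<^sub>R (w i + \<beta> (e i) (w i))"
    by (simp_all add: w_def)
  have bound: "(\<Sum>i<k. (m i)\<^sup>2 / 4) + (dist (w k) \<xi>)\<^sup>2 \<le> 1" if "k \<le> n" for k
  proof -
    obtain S where S: "S \<subseteq> {..<k}"
      "(\<Sum>i<k. (m i)\<^sup>2 / 4) + (dist (w k) \<xi>)\<^sup>2 \<le> (dist (\<beta> (sum e S) \<xi>) \<xi>)\<^sup>2"
      using barycentre_variance[where \<beta> = \<beta> and w = w and p = \<xi>, OF add zero iso w] unfolding m_def by blast
    have "S \<subseteq> {..<n}"
      using S(1) that by auto
    then have "(dist (\<beta> (sum e S) \<xi>) \<xi>)\<^sup>2 \<le> 1"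
      using small[of S] by (intro power_le_one) auto
    with S(2) show ?thesis by linarith
  qed
  have "\<exists>i<n. (m i)\<^sup>2 \<le> 4 / real n"
  proof (rule ccontr)
    assume "\<not> ?thesis"
    then have "(\<Sum>i<n. 1 / real n) < (\<Sum>i<n. (m i)\<^sup>2 / 4)"
      using n by (intro sum_strict_mono) (auto simp: field_simps)
    moreover have "n > 0" using n by simp
    then have "(\<Sum>i<n. 1 / real n) = 1" by simp
    ultimately show False using bound[of n] zero_le_power2[of "dist (w n) \<xi>"] by linarith
  qed
  then obtain i where i: "i < n" "(m i)\<^sup>2 \<le> 4 / real n" by blast
  have "(real R * m i)\<^sup>2 \<le> 1"
  proof -
    have "(real R * m i)\<^sup>2 \<le> (real R)\<^sup>2 * (4 / real n)"
      unfolding power_mult_distrib using i(2) by (intro mult_left_mono) simp_all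
    also have "\<dots> \<le> 1"
    proof -
      have "real n = 4 * (real R)\<^sup>2 + 1" "0 < 4 * (real R)\<^sup>2 + 1"
        by (simp_all add: n add_nonneg_pos)
      then show ?thesis by (simp add: divide_le_eq)
    qed
    finally show ?thesis .
  qed
  then have Rm: "real R * m i \<le> 1"
    using power2_le_imp_le[of "real R * m i" 1] by simp
  have "dist (\<beta> (real k *\<^sub>R e i) (w i)) (w i) \<le> real k * m i" for k
  proof (induction k)
    case (Suc k)
    have "dist (\<beta> (real (Suc k) *\<^sub>R e i) (w i)) (w i)
        \<le> dist (\<beta> (e i) (\<beta> (real k *\<^sub>R e i) (w i))) (\<beta> (e i) (w i)) + dist (\<beta> (e i) (w i)) (w i)"
      unfolding of_nat_Suc scaleR_add_left add scaleR_one by (rule dist_triangle)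
    also have "\<dots> \<le> real (Suc k) * m i"
      using Suc by (simp add: iso m_def dist_commute distrib_right)
    finally show ?case .
  qed (simp add: zero)
  then have "dist (\<beta> (real R *\<^sub>R e i) (w i)) (w i) \<le> 1" using Rm order_trans by blast
  moreover have "dist (w i) \<xi> \<le> 1"
  proof -
    have "(dist (w i) \<xi>)\<^sup>2 \<le> 1"
      using bound[of i] i(1) sum_nonneg[of "{..<i}" "\<lambda>i. (m i)\<^sup>2 / 4"] by simp
    then show ?thesis
      using power2_le_imp_le[of "dist (w i) \<xi>" 1] by simp
  qed
  moreover have "dist (\<beta> (real R *\<^sub>R e i) \<xi>) (\<beta> (real R *\<^sub>R e i) (w i)) = dist (w i) \<xi>"
    by (simp add: iso dist_commute)
  ultimately have "dist (\<beta> (real R *\<^sub>R e i) \<xi>) \<xi> \<le> 3"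
    using dist_triangle[of "\<beta> (real R *\<^sub>R e i) \<xi>" \<xi> "\<beta> (real R *\<^sub>R e i) (w i)"]
      dist_triangle[of "\<beta> (real R *\<^sub>R e i) (w i)" \<xi> "w i"] by linarith
  with i(1) show ?thesis by blast
qed

section \<open>Unipotent matrices are metrically proper\<close>

definition entry_norm :: "'a::real_normed_vector^2^2 \<Rightarrow> real" where
  "entry_norm M = norm (M$1$1) + norm (M$1$2) + norm (M$2$1) + norm (M$2$2)"

lemma entry_norm_nonneg: "0 \<le> entry_norm M"
  by (simp add: entry_norm_def)

lemma entry_norm_0 [simp]: "entry_norm 0 = 0"
  by (simp add: entry_norm_def)

lemma entry_norm_add: "entry_norm (M + N) \<le> entry_norm M + entry_norm N"
  unfolding entry_norm_def
  using norm_triangle_ineq[of "M$1$1" "N$1$1"] norm_triangle_ineq[of "M$1$2" "N$1$2"]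
    norm_triangle_ineq[of "M$2$1" "N$2$1"] norm_triangle_ineq[of "M$2$2" "N$2$2"] by simp

lemma entry_norm_mult:
  fixes M N :: "'a::real_normed_algebra_1^2^2"
  shows "entry_norm (M ** N) \<le> entry_norm M * entry_norm N"
proof -
  have e: "norm ((M ** N)$i$j) \<le> norm (M$i$1) * norm (N$1$j) + norm (M$i$2) * norm (N$2$j)" for i j
    by (simp add: matrix_matrix_mult_def sum_2) (intro norm_triangle_le add_mono norm_mult_ineq)
  have "entry_norm (M ** N) \<le> (norm (M$1$1) + norm (M$2$1)) * (norm (N$1$1) + norm (N$1$2))
      + (norm (M$1$2) + norm (M$2$2)) * (norm (N$2$1) + norm (N$2$2))"
    unfolding entry_norm_def using e[of 1 1] e[of 1 2] e[of 2 1] e[of 2 2]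
    by (simp add: algebra_simps)
  also have "\<dots> \<le> entry_norm M * entry_norm N"
    unfolding entry_norm_def by (simp add: algebra_simps)
  finally show ?thesis .
qed

lemma matrix_diff_ldistrib: "A ** (B - C) = A ** B - A ** (C :: 'a::ring_1^'n^'m)"
  by (simp add: vec_eq_iff matrix_matrix_mult_def right_diff_distrib sum_subtractf)

lemma matrix_diff_rdistrib: "(B - C) ** A = B ** A - C ** (A :: 'a::ring_1^'n^'m)"
  by (simp add: vec_eq_iff matrix_matrix_mult_def left_diff_distrib sum_subtractf)

lemma matrix_inv_mult:
  fixes M :: "'a::ring_1^'n^'n"
  assumes "invertible M"
  shows "M ** matrix_inv M = mat 1" "matrix_inv M ** M = mat 1"
  using assms unfolding invertible_def matrix_inv_def by (metis (mono_tags, lifting) someI_ex)+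

text \<open>
  The entry norm is not \<open>1\<close> at the identity matrix, but \<open>M \<mapsto> ln (1 + entry_norm (M - 1))\<close>
  is still subadditive because \<open>M N - 1 = (M - 1) (N - 1) + (M - 1) + (N - 1)\<close>.
\<close>

definition matrix_length :: "'a::real_normed_algebra_1^2^2 \<Rightarrow> real" where
  "matrix_length M = ln (1 + entry_norm (M - mat 1))"

lemma matrix_length_nonneg: "0 \<le> matrix_length M"
  by (simp add: matrix_length_def entry_norm_nonneg)

lemma matrix_length_mult: "matrix_length (M ** N) \<le> matrix_length M + matrix_length N"
proof -
  have eq: "M ** N - mat 1 = (M - mat 1) ** (N - mat 1) + ((M - mat 1) + (N - mat 1))"
    by (simp add: matrix_diff_ldistrib matrix_diff_rdistrib)
  have "entry_norm (M ** N - mat 1) \<le> entry_norm (M - mat 1) * entry_norm (N - mat 1)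
      + (entry_norm (M - mat 1) + entry_norm (N - mat 1))"
    unfolding eq using entry_norm_add[of "(M - mat 1) ** (N - mat 1)" "(M - mat 1) + (N - mat 1)"]
      entry_norm_add[of "M - mat 1" "N - mat 1"] entry_norm_mult[of "M - mat 1" "N - mat 1"] by linarith
  then have "1 + entry_norm (M ** N - mat 1) \<le> (1 + entry_norm (M - mat 1)) * (1 + entry_norm (N - mat 1))"
    by (simp add: algebra_simps)
  then have "matrix_length (M ** N) \<le> ln ((1 + entry_norm (M - mat 1)) * (1 + entry_norm (N - mat 1)))"
    unfolding matrix_length_def using entry_norm_nonneg[of "M ** N - mat 1"] by (intro ln_mono) linarith+
  also have "\<dots> = matrix_length M + matrix_length N"
    unfolding matrix_length_def
    using entry_norm_nonneg[of "M - mat 1"] entry_norm_nonneg[of "N - mat 1"] by (intro ln_mult_pos) linarith+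
  finally show ?thesis .
qed

text \<open>Left invariant because it depends on \<open>K = M^-1 N\<close> only; the second term
  restores symmetry, since \<open>K\<close> and its inverse may differ in length.\<close>

definition matrix_dist :: "'a::real_normed_algebra_1^2^2 \<Rightarrow> 'a^2^2 \<Rightarrow> real" where
  "matrix_dist M N = matrix_length (matrix_inv M ** N) + matrix_length (matrix_inv N ** M)"

lemma matrix_dist_triangle:
  assumes "invertible N"
  shows "matrix_dist L M \<le> matrix_dist L N + matrix_dist N M"
proof -
  have *: "matrix_length (matrix_inv A ** B) \<le> matrix_length (matrix_inv A ** N) + matrix_length (matrix_inv N ** B)" for A B
  proof -
    have "matrix_inv A ** B = matrix_inv A ** (N ** matrix_inv N) ** B"
      by (simp add: matrix_inv_mult[OF assms])
    also have "\<dots> = (matrix_inv A ** N) ** (matrix_inv N ** B)"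
      by (simp only: matrix_mul_assoc)
    finally show ?thesis using matrix_length_mult by metis
  qed
  show ?thesis
    unfolding matrix_dist_def using *[of L M] *[of M L] by linarith
qed

lemma matrix_inv_left_mult_cancel:
  fixes L M N :: "'a::ring_1^'n^'n"
  assumes "invertible L" "invertible M"
  shows "matrix_inv (L ** M) ** (L ** N) = matrix_inv M ** N"
proof -
  have "(matrix_inv M ** matrix_inv L) ** (L ** M) = matrix_inv M ** (matrix_inv L ** L) ** M"
    "(L ** M) ** (matrix_inv M ** matrix_inv L) = L ** (M ** matrix_inv M) ** matrix_inv L"
    by (simp_all only: matrix_mul_assoc)
  then have inv: "(matrix_inv M ** matrix_inv L) ** (L ** M) = mat 1"
    "(L ** M) ** (matrix_inv M ** matrix_inv L) = mat 1"
    using assms by (simp_all add: matrix_inv_mult)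
  then have "invertible (L ** M)" unfolding invertible_def by blast
  then have "matrix_inv (L ** M) = matrix_inv M ** matrix_inv L"
    using inv matrix_inv_mult[of "L ** M"] by (metis matrix_mul_assoc matrix_mul_lid matrix_mul_rid)
  then have "matrix_inv (L ** M) ** (L ** N) = matrix_inv M ** (matrix_inv L ** L) ** N"
    by (simp only: matrix_mul_assoc)
  then show ?thesis using assms by (simp add: matrix_inv_mult)
qed

text \<open>
  With \<open>K = M\<^sup>-\<^sup>1 N\<close>, the identity \<open>K\<^sup>-\<^sup>1 - 1 = - ((K\<^sup>-\<^sup>1 - 1) (K - 1) + (K - 1))\<close>
  bounds \<open>K\<^sup>-\<^sup>1 - 1\<close> by a geometric series.
\<close>

lemma matrix_dist_le:
  fixes M N :: "'a::real_normed_algebra_1^2^2"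
  assumes "invertible M" "invertible N"
    and small: "entry_norm (matrix_inv M) * entry_norm (N - M) \<le> 1/2"
  shows "matrix_dist M N \<le> 3 * (entry_norm (matrix_inv M) * entry_norm (N - M))"
proof -
  define \<eta> where "\<eta> = entry_norm (matrix_inv M) * entry_norm (N - M)"
  define K where "K = matrix_inv M ** N"
  define K' where "K' = matrix_inv N ** M"
  have "K - mat 1 = matrix_inv M ** (N - M)"
    by (simp add: K_def matrix_diff_ldistrib matrix_inv_mult assms)
  then have K: "entry_norm (K - mat 1) \<le> \<eta>"
    unfolding \<eta>_def using entry_norm_mult by metis
  have "K' ** K = matrix_inv N ** (M ** matrix_inv M) ** N"
    by (simp only: K_def K'_def matrix_mul_assoc)
  then have "K' ** K = mat 1" by (simp add: matrix_inv_mult assms)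
  then have "K' - mat 1 = (mat 1 - K') ** (K - mat 1) + (mat 1 - K)"
    by (simp add: matrix_diff_ldistrib matrix_diff_rdistrib)
  then have "entry_norm (K' - mat 1) \<le> entry_norm ((mat 1 - K') ** (K - mat 1)) + entry_norm (mat 1 - K)"
    using entry_norm_add by metis
  also have "\<dots> \<le> entry_norm (mat 1 - K') * entry_norm (K - mat 1) + entry_norm (mat 1 - K)"
    using entry_norm_mult by (intro add_right_mono)
  also have "\<dots> = entry_norm (K' - mat 1) * entry_norm (K - mat 1) + entry_norm (K - mat 1)"
    by (simp add: entry_norm_def norm_minus_commute)
  \<comment> \<open>As \<open>\<eta> <= 1/2\<close>, half of the left side is absorbed:
    \<open>2 \<eta>\<close> for \<open>K'\<close> and \<open>\<eta>\<close> for \<open>K\<close>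
    make the factor 3.\<close>
  also have "\<dots> \<le> entry_norm (K' - mat 1) * (1/2) + \<eta>"
    using K small entry_norm_nonneg[of "K' - mat 1"] by (intro add_mono mult_left_mono) (simp_all add: \<eta>_def)
  finally have "entry_norm (K' - mat 1) \<le> 2 * \<eta>" by simp
  moreover have "matrix_length A \<le> entry_norm (A - mat 1)" for A :: "'a^2^2"
    unfolding matrix_length_def using entry_norm_nonneg by (rule ln_add_one_self_le_self)
  ultimately show ?thesis
    unfolding matrix_dist_def \<eta>_def[symmetric] K_def[symmetric] K'_def[symmetric]
    using K by (smt (verit, best))
qed

text \<open>Smallness of the distance near each fixed matrix, from \<open>matrix_dist_le\<close>,
  yields joint continuity by the triangle inequality.\<close>

lemma continuous_map_matrix_dist:
  fixes S :: "('a::real_normed_algebra_1^2^2) set"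
  assumes inv: "\<And>M. M \<in> S \<Longrightarrow> invertible M"
  shows "continuous_map (prod_topology (top_of_set S) (top_of_set S)) euclideanreal (\<lambda>(M, N). matrix_dist M N)"
proof -
  have sym: "matrix_dist M N = matrix_dist N M" for M N :: "'a^2^2"
    by (simp add: matrix_dist_def)
  have "continuous_on (S \<times> S) (\<lambda>(M, N). matrix_dist M N)"
  proof (rule continuous_onI)
    have close: "\<exists>d>0. \<forall>M\<in>S. dist M M0 < d \<longrightarrow> matrix_dist M0 M \<le> e" if M0: "M0 \<in> S" and e: "e > 0" for M0 e
    proof -
      define C where "C = entry_norm (matrix_inv M0)"
      have "((\<lambda>M. C * entry_norm (M - M0)) \<longlongrightarrow> C * entry_norm (M0 - M0)) (nhds M0)"
        unfolding entry_norm_def by (intro tendsto_intros tendsto_ident_at filterlim_ident)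
      \<comment> \<open>The bound \<open>1/2\<close> is the hypothesis of
        \<open>matrix_dist_le\<close>, and \<open>e/3\<close> offsets its factor 3.\<close>
      then have "eventually (\<lambda>M. C * entry_norm (M - M0) < min (1/2) (e/3)) (nhds M0)"
        by (rule order_tendstoD) (use e in simp)
      then obtain d where d: "d > 0" "\<And>M. dist M M0 < d \<Longrightarrow> C * entry_norm (M - M0) < min (1/2) (e/3)"
        unfolding eventually_nhds_metric by blast
      have "matrix_dist M0 M \<le> e" if "M \<in> S" "dist M M0 < d" for M
        using matrix_dist_le[of M0 M] d(2)[OF that(2)] inv M0 that(1) by (simp add: C_def)
      with d(1) show ?thesis by blast
    qed
    fix x :: "('a^2^2) \<times> ('a^2^2)" and e :: real assume x: "x \<in> S \<times> S" and e: "e > 0"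
    obtain M0 N0 where x_eq: "x = (M0, N0)" "M0 \<in> S" "N0 \<in> S" using x by auto
    obtain d1 where d1: "d1 > 0" "\<And>M. M \<in> S \<Longrightarrow> dist M M0 < d1 \<Longrightarrow> matrix_dist M0 M \<le> e/2"
      using close[OF x_eq(2), of "e/2"] e by auto
    obtain d2 where d2: "d2 > 0" "\<And>M. M \<in> S \<Longrightarrow> dist M N0 < d2 \<Longrightarrow> matrix_dist N0 M \<le> e/2"
      using close[OF x_eq(3), of "e/2"] e by auto
    show "\<exists>d>0. \<forall>x'\<in>S \<times> S. dist x' x < d \<longrightarrow>
        dist (case x' of (M, N) \<Rightarrow> matrix_dist M N) (case x of (M, N) \<Rightarrow> matrix_dist M N) \<le> e"
    proof (intro exI[of _ "min d1 d2"] conjI ballI impI)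
      fix x' assume x': "x' \<in> S \<times> S" "dist x' x < min d1 d2"
      obtain M N where x'_eq: "x' = (M, N)" "M \<in> S" "N \<in> S" using x' by auto
      have "dist M M0 < d1" "dist N N0 < d2"
        using x'(2) dist_fst_le[of x' x] dist_snd_le[of x' x] by (simp_all add: x_eq x'_eq)
      then have "matrix_dist M0 M \<le> e/2" "matrix_dist N0 N \<le> e/2"
        using d1 d2 x'_eq by simp_all
      moreover have "invertible M" "invertible N" "invertible M0" "invertible N0"
        using inv x_eq x'_eq by simp_all
      ultimately show "dist (case x' of (M, N) \<Rightarrow> matrix_dist M N) (case x of (M, N) \<Rightarrow> matrix_dist M N) \<le> e"
        using matrix_dist_triangle[of M0 M N] matrix_dist_triangle[of N0 M0 N]
          matrix_dist_triangle[of M M0 N0] matrix_dist_triangle[of N M N0]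
          sym[of M M0] sym[of N N0]
        by (simp add: x_eq x'_eq dist_real_def abs_le_iff)
    qed (use d1 d2 in simp)
  qed
  then show ?thesis
    by (simp flip: subtopology_Times)
qed

section \<open>The subgroup of unipotent matrices\<close>

definition unipotent :: "'a::ring_1 \<Rightarrow> 'a^2^2" where
  "unipotent a = vector [vector [1, a], vector [0, 1]]"

lemma unipotent_entries [simp]:
  "unipotent a $ 1 $ 1 = 1" "unipotent a $ 1 $ 2 = a" "unipotent a $ 2 $ 1 = 0" "unipotent a $ 2 $ 2 = 1"
  by (simp_all add: unipotent_def)

lemma unipotent_add: "unipotent (a + b) = unipotent a ** unipotent b"
  by (simp add: vec_eq_iff forall_2 matrix_matrix_mult_def sum_2 add.commute)

lemma unipotent_0: "unipotent 0 = mat 1"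
  by (simp add: vec_eq_iff forall_2 mat_def)

lemma invertible_unipotent: "invertible (unipotent a)"
  unfolding invertible_def
  by (rule exI[of _ "unipotent (- a)"]) (simp add: unipotent_0 flip: unipotent_add)

lemma continuous_on_unipotent: "continuous_on UNIV (unipotent :: 'a::real_normed_algebra_1 \<Rightarrow> _)"
proof -
  have "continuous_on UNIV (\<lambda>a :: 'a. unipotent a $ i $ j)" for i j :: 2
    using exhaust_2[of i] exhaust_2[of j] by (auto intro: continuous_intros)
  then have "continuous_on UNIV (\<lambda>a :: 'a. \<chi> i j. unipotent a $ i $ j)"
    by (intro continuous_on_vec_lambda)
  then show ?thesis by simp
qed

text \<open>The first of the two lengths already equals the left side. The logarithm is harmless,
  being unbounded.\<close>

lemma norm_le_of_matrix_dist_unipotent: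
  fixes a :: "'a::real_normed_algebra_1"
  shows "ln (1 + norm a) \<le> matrix_dist (mat 1) (unipotent a)"
proof -
  have "matrix_inv (mat 1 :: 'a^2^2) = mat 1"
    using matrix_inv_mult(1)[of "mat 1 :: 'a^2^2"] by (simp add: invertible_def)
  moreover have "entry_norm (unipotent a - mat 1) = norm a"
    by (simp add: entry_norm_def mat_def)
  ultimately have "matrix_length (matrix_inv (mat 1) ** unipotent a) = ln (1 + norm a)"
    by (simp add: matrix_length_def)
  then show ?thesis
    unfolding matrix_dist_def using matrix_length_nonneg[of "matrix_inv (unipotent a) ** mat 1"] by linarith
qed

text \<open>Serves both groups: the action is only examined on the unipotents, a copy of the
  additive group of the algebra.\<close>

lemma not_haagerup_if_unipotents:
  fixes G :: "('a::unital_cstar_algebra^2^2) monoid"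
  assumes inf: "infinite_dimensional TYPE('a)"
    and G: "mult G = (**)" "one G = mat 1" "carrier G \<subseteq> {M. invertible M}" "range unipotent \<subseteq> carrier G"
  shows "\<not> haagerup_on TYPE('h::{real_inner, complete_space}) G (top_of_set (carrier G))"
proof
  assume "haagerup_on TYPE('h) G (top_of_set (carrier G))"
  then obtain \<alpha> :: "'a^2^2 \<Rightarrow> 'h \<Rightarrow> 'h" and \<xi> where act: "group_action G UNIV \<alpha>"
    and aff: "\<And>g. g \<in> carrier G \<Longrightarrow> affine_isometry (\<alpha> g)"
    and cont: "continuous_map (prod_topology (top_of_set (carrier G)) euclidean) euclidean (\<lambda>(g, x). \<alpha> g x)"
    and proper: "filterlim (\<lambda>g. norm (\<alpha> g \<xi>)) at_top (group_at_infinity G (top_of_set (carrier G)))"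
    unfolding haagerup_on_def by blast
  have inv: "invertible M" if "M \<in> carrier G" for M using G(3) that by blast
  define \<beta> where "\<beta> a = \<alpha> (unipotent a)" for a
  have uG: "unipotent a \<in> carrier G" for a using G(4) by blast
  have add: "\<beta> (a + b) x = \<beta> a (\<beta> b x)" for a b x
    using group_action.composition_rule[OF act UNIV_I uG uG] by (simp add: \<beta>_def unipotent_add G(1))
  have zero: "\<beta> 0 x = x" for x
    using group_action.id_eq_one[OF act] by (simp add: \<beta>_def unipotent_0 G(2) restrict_def fun_eq_iff)
  have iso: "dist (\<beta> a x) (\<beta> a y) = dist x y" for a x y
    using aff[OF uG[of a]] by (simp add: \<beta>_def affine_isometry_def)
  have "filterlim unipotent (group_at_infinity G (top_of_set (carrier G))) at_infinity"
    unfolding group_at_infinity_def filterlim_INF filterlim_principal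
  proof safe
    fix B assume B: "group_bounded G (top_of_set (carrier G)) B"
    have "left_invariant_pseudometric G matrix_dist"
      unfolding left_invariant_pseudometric_def G(1)
    proof (intro conjI ballI)
      fix x y assume "x \<in> carrier G" "y \<in> carrier G"
      show "0 \<le> matrix_dist x y" "matrix_dist x y = matrix_dist y x"
        by (simp_all add: matrix_dist_def matrix_length_nonneg)
    next
      fix x assume "x \<in> carrier G"
      then show "matrix_dist x x = 0"
        using inv by (simp add: matrix_dist_def matrix_inv_mult matrix_length_def)
    next
      fix x y z assume "y \<in> carrier G"
      then show "matrix_dist x z \<le> matrix_dist x y + matrix_dist y z"
        using inv by (intro matrix_dist_triangle)
    next
      fix z x y assume "z \<in> carrier G" "x \<in> carrier G" "y \<in> carrier G"
      then show "matrix_dist (z ** x) (z ** y) = matrix_dist x y"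
        using inv by (simp add: matrix_dist_def matrix_inv_left_mult_cancel)
    qed
    moreover have "continuous_map (prod_topology (top_of_set (carrier G)) (top_of_set (carrier G)))
        euclideanreal (\<lambda>(M, N). matrix_dist M N)"
      using inv by (rule continuous_map_matrix_dist)
    ultimately obtain C where C: "\<And>x y. x \<in> B \<Longrightarrow> y \<in> B \<Longrightarrow> matrix_dist x y \<le> C"
      using B unfolding group_bounded_def by blast
    show "eventually (\<lambda>a. unipotent a \<in> carrier G - B) at_infinity"
    proof (cases "B = {}")
      case True
      then show ?thesis using uG by simp
    next
      case False
      then obtain M where M: "M \<in> B" "invertible M" using B G(3) by (auto simp: group_bounded_def)
      \<comment> \<open>The identity need not lie in \<open>B\<close>, so distances from it are
        measured through a point \<open>M\<close> of \<open>B\<close>.\<close>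
      define D where "D = matrix_dist (mat 1) M + C"
      have "unipotent a \<notin> B" if "exp D \<le> norm a" for a
      proof
        assume "unipotent a \<in> B"
        then have "matrix_dist (mat 1) (unipotent a) \<le> D"
          unfolding D_def using matrix_dist_triangle[OF M(2), of "mat 1" "unipotent a"] C[OF M(1)] by fastforce
        then have "ln (1 + norm a) \<le> D" using norm_le_of_matrix_dist_unipotent order_trans by blast
        then have "exp (ln (1 + norm a)) \<le> exp D" by simp
        moreover have "exp (ln (1 + norm a)) = 1 + norm a" by (simp add: add_pos_nonneg)
        ultimately show False using that by simp
      qed
      then show ?thesis unfolding eventually_at_infinity using uG by blast
    qed
  qed
  then have "filterlim (\<lambda>a. norm (\<beta> a \<xi>)) at_top at_infinity"
    using filterlim_compose[OF proper] by (simp add: \<beta>_def)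
  \<comment> \<open>The margin 3 is the displacement in
    \<open>small_subset_sums_imp_small_multiple\<close>.\<close>
  then have "eventually (\<lambda>a. norm (\<beta> a \<xi>) > norm \<xi> + 3) at_infinity"
    by (simp add: filterlim_at_top_dense)
  then obtain K where K: "\<And>a. norm a \<ge> K \<Longrightarrow> norm (\<beta> a \<xi>) > norm \<xi> + 3"
    unfolding eventually_at_infinity by blast
  have "prod_topology (top_of_set (carrier G)) (euclidean :: 'h topology) = top_of_set (carrier G \<times> UNIV)"
    using subtopology_Times[of euclidean euclidean "carrier G" "UNIV :: 'h set"] by simp
  then have "continuous_on (carrier G \<times> UNIV) (\<lambda>(g, x). \<alpha> g x)"
    using cont by simp
  then have "continuous_on UNIV (\<lambda>a. (\<lambda>(g, x). \<alpha> g x) (unipotent a, \<xi>))"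
    by (rule continuous_on_compose2) (use uG in \<open>auto intro!: continuous_intros continuous_on_unipotent\<close>)
  then have "continuous_on UNIV (\<lambda>a. \<beta> a \<xi>)" by (simp add: \<beta>_def)
  then have "\<forall>r>0. \<exists>d>0. \<forall>a. dist a 0 < d \<longrightarrow> dist (\<beta> a \<xi>) (\<beta> 0 \<xi>) < r"
    unfolding continuous_on_iff by blast
  then obtain d where d: "d > 0" "\<And>a. dist a 0 < d \<Longrightarrow> dist (\<beta> a \<xi>) (\<beta> 0 \<xi>) < 1"
    using zero_less_one by blast
  \<comment> \<open>Subset sums have norm at most 2, so after scaling at most
    \<open>2 c < d\<close>.\<close>
  define c where "c = d / 3"
  obtain R :: nat where R: "K < real R * c"
    using reals_Archimedean3[of c] d(1) by (auto simp: c_def)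
  \<comment> \<open>\<open>K\<close>, \<open>c\<close> and \<open>R\<close> are fixed before
    \<open>n\<close>, so the vectors \<open>e i\<close> may depend on all of them.\<close>
  define n where "n = 4 * R\<^sup>2 + 1"
  obtain e :: "nat \<Rightarrow> 'a" where e: "\<And>i. i < n \<Longrightarrow> norm (e i) = 1" "\<And>S. S \<subseteq> {..<n} \<Longrightarrow> norm (sum e S) \<le> 2"
    using infinite_dimensional_bounded_subset_sums[OF inf] by blast
  have "dist (\<beta> (\<Sum>i\<in>S. c *\<^sub>R e i) \<xi>) \<xi> \<le> 1" if "S \<subseteq> {..<n}" for S
  proof -
    have "norm (c *\<^sub>R sum e S) \<le> c * 2"
      using e(2)[OF that] d(1) by (simp add: c_def)
    then show ?thesis
      using d(2)[of "c *\<^sub>R sum e S"] d(1) by (simp add: zero c_def scaleR_sum_right)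
  qed
  then obtain i where i: "i < n" "dist (\<beta> (real R *\<^sub>R c *\<^sub>R e i) \<xi>) \<xi> \<le> 3"
    using small_subset_sums_imp_small_multiple[where \<beta> = \<beta> and e = "\<lambda>i. c *\<^sub>R e i", OF add zero iso _ n_def] by blast
  have "norm (real R *\<^sub>R c *\<^sub>R e i) \<ge> K"
    using R e(1)[OF i(1)] d(1) by (simp add: c_def)
  then have "norm (\<beta> (real R *\<^sub>R c *\<^sub>R e i) \<xi>) > norm \<xi> + 3" by (rule K)
  moreover have "norm (\<beta> (real R *\<^sub>R c *\<^sub>R e i) \<xi>) \<le> norm \<xi> + dist (\<beta> (real R *\<^sub>R c *\<^sub>R e i) \<xi>) \<xi>"
    by (metis dist_norm norm_triangle_sub)
  ultimately show False using i(2) by simp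
qed

theorem theoremD:
  assumes "infinite_dimensional TYPE('a::unital_cstar_algebra)"
  shows "\<not> haagerup_on TYPE('h::{real_inner, complete_space})
            (E2 :: ('a^2^2) monoid) (top_of_set (carrier E2)) \<and>
         (separable_space (euclidean :: 'a topology) \<and> (\<forall>x y :: 'a. x * y = y * x) \<longrightarrow>
          \<not> haagerup_on TYPE('h)
            (SL2 :: ('a^2^2) monoid) (top_of_set (carrier SL2)))"
proof -
  have "carrier E2 \<subseteq> carrier (GL2 :: ('a^2^2) monoid)"
    using subgroup.subset[OF subgroup_E2] .
  then have "\<not> haagerup_on TYPE('h) (E2 :: ('a^2^2) monoid) (top_of_set (carrier E2))"
    by (intro not_haagerup_if_unipotents[OF assms])
      (auto simp: E2_def GL2_def elementary_matrices_def unipotent_def)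
  moreover have "\<not> haagerup_on TYPE('h) (SL2 :: ('a^2^2) monoid) (top_of_set (carrier SL2))"
    by (intro not_haagerup_if_unipotents[OF assms])
      (auto simp: SL2_def GL2_def det2_def invertible_unipotent)
  ultimately show ?thesis by blast
qed

end
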